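(* Let $M$ be a STCR lightlike submanifold of an indefinite Kähler manifold $\bar M$. Then the distribution $D$ is integrable if and only if, for all $X,Y\in\Gamma(D)$, $$h^s(X,\bar JY)-h^s(Y,\bar JX)\in\Gamma(\bar J(L_2))\qquad\text{and}\qquad h^l(X,\bar JY)-h^l(Y,\bar JX)\in\Gamma(L_2).$$
   Context: Indefinite Kähler manifold $(\bar M,\bar J,\bar g)$: a semi-Riemannian manifold of constant index $q$, $0<q<\dim\bar M$, with an almost complex structure $\bar J$ ($\bar J^2=-I$) satisfying $\bar g(\bar JX,\bar JY)=\bar g(X,Y)$ and $\bar\nabla\bar J=0$, where $\bar\nabla$ is the Levi-Civita connection of $\bar g$. Lightlike submanifold: a submanifold $M$ of dimension $m$ of $\bar M$ (of dimension $m+n$), with induced metric $g$, such that $Rad(TM)=TM\cap TM^\perp$ has constant rank $r$, $1\le r\le m$. One fixes non-degenerate complements: a screen distribution $S(TM)$ with $TM=S(TM)\perp Rad(TM)$ and a screen transversal bundle $S(TM^\perp)$ with $TM^\perp=S(TM^\perp)\perp Rad(TM)$. The lightlike transversal bundle $ltr(TM)$ is a rank $r$ complement of $Rad(TM)$ in the orthogonal complement of $S(TM)\perp S(TM^\perp)$ in $T\bar M|_M$, locally spanned by $N_1,\dots,N_r$ with $\bar g(\xi_i,N_j)=\delta_{ij}$, $\bar g(N_i,N_j)=0$ for a local basis $\{\xi_i\}$ of $Rad(TM)$. Put $tr(TM)=ltr(TM)\perp S(TM^\perp)$; then $T\bar M|_M=TM\oplus tr(TM)$. STCR (screen transversal Cauchy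 Riemann) lightlike submanifold: a real lightlike submanifold $M$ of $\bar M$ such that (A) there are subbundles $D_1,D_2$ of $Rad(TM)$ with $Rad(TM)=D_1\oplus D_2$, $\bar J(D_1)\subset S(TM)$, $\bar J(D_2)\subset S(TM^\perp)$; (B) there are subbundles $D_0,D'$ of $S(TM)$ with $S(TM)=\{\bar JD_1\oplus D'\}\perp D_0$, $\bar J(D_0)=D_0$, $\bar J(D')=L_1\perp S$, where $D_0$ is non-degenerate and $L_1$, $S$ are vector subbundles of $ltr(TM)$ and $S(TM^\perp)$ respectively. Moreover $ltr(TM)=L_1\oplus L_2$ with $\bar J(L_1)\subset S(TM)$, $\bar J(L_2)\subset S(TM^\perp)$, and $S(TM^\perp)=\{\bar J(D_2)\oplus\bar J(L_2)\}\perp S$. Then $TM=D\oplus\tilde D$, where $D=D_0\oplus D_1\oplus\bar JD_1$ is $\bar J$-invariant and $\tilde D=D_2\oplus\bar JL_1\oplus\bar JS$ satisfies $\bar J\tilde D\subset tr(TM)$. Gauss formula (for $X,Y\in\Gamma(TM)$): $\bar\nabla_XY=\nabla_XY+h^l(X,Y)+h^s(X,Y)$ with $\nabla_XY\in\Gamma(TM)$, $h^l(X,Y)\in\Gamma(ltr(TM))$, $h^s(X,Y)\in\Gamma(S(TM^\perp))$. *)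

theory Defs
  imports "HOL-Analysis.Analysis"
begin

section \<open>Smooth manifolds\<close>

primrec Ck_on :: "nat \<Rightarrow> 'a set \<Rightarrow> ('a::euclidean_space \<Rightarrow> 'b::real_normed_vector) \<Rightarrow> bool" where
  "Ck_on 0 S f \<longleftrightarrow> continuous_on S f"
| "Ck_on (Suc k) S f \<longleftrightarrow>
     (\<forall>x\<in>S. f differentiable (at x)) \<and> (\<forall>v. Ck_on k S (\<lambda>x. frechet_derivative f (at x) v))"

text \<open>Only meant for open \<open>S\<close>.\<close>

definition smooth_on :: "'a set \<Rightarrow> ('a::euclidean_space \<Rightarrow> 'b::real_normed_vector) \<Rightarrow> bool" where
  "smooth_on S f \<longleftrightarrow> (\<forall>k. Ck_on k S f)"

text \<open>A chart is a coordinate domain together with a coordinate map, whose values outside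
  the domain are irrelevant. The points of a manifold are all the points of a type, and the
  dimension is that of the model space.\<close>

type_synonym ('p, 'e) chart = "'p set \<times> ('p \<Rightarrow> 'e)"

abbreviation cdom :: "('p, 'e) chart \<Rightarrow> 'p set" where "cdom \<equiv> fst"
abbreviation cmap :: "('p, 'e) chart \<Rightarrow> 'p \<Rightarrow> 'e" where "cmap \<equiv> snd"
abbreviation cinv :: "('p, 'e) chart \<Rightarrow> 'e \<Rightarrow> 'p" where "cinv c \<equiv> inv_into (cdom c) (cmap c)"

locale smooth_manifold =
  fixes A :: "('p::{t2_space, second_countable_topology}, 'e::euclidean_space) chart set"
  assumes charts: "c \<in> A \<Longrightarrow> open (cdom c) \<and> open (cmap c ` cdom c) \<and>
      homeomorphism (cdom c) (cmap c ` cdom c) (cmap c) (cinv c)"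
    and cover: "(\<Union>c\<in>A. cdom c) = UNIV"
    and compatible: "c \<in> A \<Longrightarrow> d \<in> A \<Longrightarrow> smooth_on (cmap c ` (cdom c \<inter> cdom d)) (cmap d \<circ> cinv c)"

text \<open>The tangent space at \<open>p\<close> is the model space \<open>'e\<close>, a vector being identified with its
  components in the chart \<open>chart_at A p\<close> chosen once and for all at \<open>p\<close>. A vector field is thus
  a function \<open>'p \<Rightarrow> 'e\<close>; since \<open>chart_at A p\<close> may jump with \<open>p\<close>, its smoothness is only meaningful
  after passing to the components \<open>comp_in\<close> in a fixed chart. Conversely, \<open>vec_of A c p a\<close>
  is the tangent vector at \<open>p\<close> with components \<open>a\<close> in the chart \<open>c\<close>, so that
  \<open>\<lambda>p. vec_of A c p b\<close>, for \<open>b\<close> in the basis, are the coordinate vector fields of \<open>c\<close>.\<close>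

definition chart_at :: "('p, 'e) chart set \<Rightarrow> 'p \<Rightarrow> ('p, 'e) chart" where
  "chart_at A p = (SOME c. c \<in> A \<and> p \<in> cdom c)"

definition comp_in :: "('p, 'e::euclidean_space) chart set \<Rightarrow> ('p, 'e) chart \<Rightarrow> 'p \<Rightarrow> 'e \<Rightarrow> 'e" where
  "comp_in A c p v =
     frechet_derivative (cmap c \<circ> cinv (chart_at A p)) (at (cmap (chart_at A p) p)) v"

definition vec_of :: "('p, 'e::euclidean_space) chart set \<Rightarrow> ('p, 'e) chart \<Rightarrow> 'p \<Rightarrow> 'e \<Rightarrow> 'e" where
  "vec_of A c p a = frechet_derivative (cmap (chart_at A p) \<circ> cinv c) (at (cmap c p)) a"

definition smooth_function ::
  "('p, 'e::euclidean_space) chart set \<Rightarrow> 'p set \<Rightarrow> ('p \<Rightarrow> real) \<Rightarrow> bool" where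
  "smooth_function A U f \<longleftrightarrow> (\<forall>c\<in>A. smooth_on (cmap c ` (U \<inter> cdom c)) (f \<circ> cinv c))"

text \<open>The derivative \<open>v f\<close> of a function \<open>f\<close> at \<open>p\<close> in the direction of the tangent vector \<open>v\<close>.\<close>

definition dir_deriv ::
  "('p, 'e::euclidean_space) chart set \<Rightarrow> 'p \<Rightarrow> 'e \<Rightarrow> ('p \<Rightarrow> real) \<Rightarrow> real" where
  "dir_deriv A p v f = frechet_derivative (f \<circ> cinv (chart_at A p)) (at (cmap (chart_at A p) p)) v"

definition smooth_vector_field ::
  "('p, 'e::euclidean_space) chart set \<Rightarrow> 'p set \<Rightarrow> ('p \<Rightarrow> 'e) \<Rightarrow> bool" where
  "smooth_vector_field A U X \<longleftrightarrow>
     (\<forall>c\<in>A. smooth_on (cmap c ` (U \<inter> cdom c)) (\<lambda>z. comp_in A c (cinv c z) (X (cinv c z))))"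

text \<open>In coordinates, \<open>[X, Y]\<^sup>j = X\<^sup>i \<partial>\<^sub>i Y\<^sup>j - Y\<^sup>i \<partial>\<^sub>i X\<^sup>j\<close>, evaluated in the chart chosen at \<open>p\<close>.\<close>

definition lie_bracket ::
  "('p, 'e::euclidean_space) chart set \<Rightarrow> ('p \<Rightarrow> 'e) \<Rightarrow> ('p \<Rightarrow> 'e) \<Rightarrow> 'p \<Rightarrow> 'e" where
  "lie_bracket A X Y p =
     (let c = chart_at A p;
          x = (\<lambda>z. comp_in A c (cinv c z) (X (cinv c z)));
          y = (\<lambda>z. comp_in A c (cinv c z) (Y (cinv c z)))
      in frechet_derivative y (at (cmap c p)) (X p) - frechet_derivative x (at (cmap c p)) (Y p))"


section \<open>Semi-Riemannian and indefinite Kaehler manifolds\<close>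

text \<open>The largest dimension of a subspace on which the form is negative definite.\<close>

definition form_index :: "('e::euclidean_space \<Rightarrow> 'e \<Rightarrow> real) \<Rightarrow> nat" where
  "form_index b = Max {dim V |V. subspace V \<and> (\<forall>v\<in>V. v \<noteq> 0 \<longrightarrow> b v v < 0)}"

definition nondegenerate_on :: "('e::euclidean_space \<Rightarrow> 'e \<Rightarrow> real) \<Rightarrow> 'e set \<Rightarrow> bool" where
  "nondegenerate_on b V \<longleftrightarrow> (\<forall>v\<in>V. (\<forall>w\<in>V. b v w = 0) \<longrightarrow> v = 0)"

locale semi_riemannian_manifold = smooth_manifold A
  for A :: "('p::{t2_space, second_countable_topology}, 'e::euclidean_space) chart set" +
  fixes g :: "'p \<Rightarrow> 'e \<Rightarrow> 'e \<Rightarrow> real" and q :: nat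
  assumes metric_bilinear: "bilinear (g p)"
    and metric_symmetric: "g p v w = g p w v"
    and metric_nondegenerate: "nondegenerate_on (g p) UNIV"
    and metric_smooth: "c \<in> A \<Longrightarrow> smooth_on (cmap c ` cdom c)
      (\<lambda>z. g (cinv c z) (vec_of A c (cinv c z) a) (vec_of A c (cinv c z) b))"
    and metric_index: "form_index (g p) = q"

text \<open>\<open>nabla p v Y\<close> is the covariant derivative at \<open>p\<close>, in the direction \<open>v\<close>, of a
  vector field \<open>Y\<close> that is smooth near \<open>p\<close>.\<close>

locale affine_connection = smooth_manifold A
  for A :: "('p::{t2_space, second_countable_topology}, 'e::euclidean_space) chart set" +
  fixes nabla :: "'p \<Rightarrow> 'e \<Rightarrow> ('p \<Rightarrow> 'e) \<Rightarrow> 'e"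
  assumes nabla_linear: "open U \<Longrightarrow> p \<in> U \<Longrightarrow> smooth_vector_field A U Y \<Longrightarrow> linear (\<lambda>v. nabla p v Y)"
    and nabla_add: "open U \<Longrightarrow> p \<in> U \<Longrightarrow> smooth_vector_field A U Y \<Longrightarrow> smooth_vector_field A U Z \<Longrightarrow>
      nabla p v (\<lambda>x. Y x + Z x) = nabla p v Y + nabla p v Z"
    and nabla_leibniz: "open U \<Longrightarrow> p \<in> U \<Longrightarrow> smooth_function A U f \<Longrightarrow> smooth_vector_field A U Y \<Longrightarrow>
      nabla p v (\<lambda>x. f x *\<^sub>R Y x) = dir_deriv A p v f *\<^sub>R Y p + f p *\<^sub>R nabla p v Y"
    and nabla_smooth: "open U \<Longrightarrow> smooth_vector_field A U X \<Longrightarrow> smooth_vector_field A U Y \<Longrightarrow>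
      smooth_vector_field A U (\<lambda>x. nabla x (X x) Y)"

locale levi_civita_connection = semi_riemannian_manifold A g q + affine_connection A nabla
  for A :: "('p::{t2_space, second_countable_topology}, 'e::euclidean_space) chart set"
    and g q nabla +
  assumes torsion_free: "open U \<Longrightarrow> p \<in> U \<Longrightarrow> smooth_vector_field A U X \<Longrightarrow> smooth_vector_field A U Y \<Longrightarrow>
      nabla p (X p) Y - nabla p (Y p) X = lie_bracket A X Y p"
    and metric_parallel: "open U \<Longrightarrow> p \<in> U \<Longrightarrow> smooth_vector_field A U Y \<Longrightarrow> smooth_vector_field A U Z \<Longrightarrow>
      dir_deriv A p v (\<lambda>x. g x (Y x) (Z x)) = g p (nabla p v Y) (Z p) + g p (Y p) (nabla p v Z)"

locale indefinite_kaehler_manifold = levi_civita_connection A g q nabla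
  for A :: "('p::{t2_space, second_countable_topology}, 'e::euclidean_space) chart set"
    and g q nabla +
  fixes J :: "'p \<Rightarrow> 'e \<Rightarrow> 'e"
  assumes index_pos: "0 < q" and index_less: "q < DIM('e)"
    and J_linear: "linear (J p)"
    and J_smooth: "c \<in> A \<Longrightarrow> smooth_on (cmap c ` cdom c)
      (\<lambda>z. comp_in A c (cinv c z) (J (cinv c z) (vec_of A c (cinv c z) a)))"
    and J_square: "J p (J p v) = - v"
    and J_isometry: "g p (J p v) (J p w) = g p v w"
    and J_parallel: "open U \<Longrightarrow> p \<in> U \<Longrightarrow> smooth_vector_field A U Y \<Longrightarrow>
      nabla p v (\<lambda>x. J x (Y x)) = J p (nabla p v Y)"


section \<open>Submanifolds and bundles along them\<close>

text \<open>The submanifold \<open>M\<close>, with atlas \<open>B\<close>, is given by an injective immersion \<open>\<iota>\<close> into the ambient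
  manifold with atlas \<open>A\<close>. Bundles over \<open>M\<close> are families of subspaces \<open>E p\<close> of the ambient
  tangent space at \<open>\<iota> p\<close>, and sections along \<open>M\<close> are functions \<open>'m \<Rightarrow> 'e\<close>; in particular
  \<open>TM\<close> is identified with the image of the differential of \<open>\<iota>\<close>.\<close>

definition push ::
  "('p, 'e::euclidean_space) chart set \<Rightarrow> ('m, 'f::euclidean_space) chart set \<Rightarrow> ('m \<Rightarrow> 'p) \<Rightarrow>
    'm \<Rightarrow> 'f \<Rightarrow> 'e" where
  "push A B \<iota> p v = frechet_derivative (cmap (chart_at A (\<iota> p)) \<circ> \<iota> \<circ> cinv (chart_at B p))
     (at (cmap (chart_at B p) p)) v"

locale immersed_submanifold = ambient: smooth_manifold A + smooth_manifold B
  for A :: "('p::{t2_space, second_countable_topology}, 'e::euclidean_space) chart set"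
    and B :: "('m::{t2_space, second_countable_topology}, 'f::euclidean_space) chart set" +
  fixes \<iota> :: "'m \<Rightarrow> 'p"
  assumes \<iota>_continuous: "continuous_on UNIV \<iota>"
    and \<iota>_smooth: "c \<in> A \<Longrightarrow> k \<in> B \<Longrightarrow>
      smooth_on (cmap k ` (cdom k \<inter> \<iota> -` cdom c)) (cmap c \<circ> \<iota> \<circ> cinv k)"
    and \<iota>_inj: "inj \<iota>"
    and \<iota>_immersion: "inj (push A B \<iota> p)"

definition smooth_along ::
  "('p, 'e::euclidean_space) chart set \<Rightarrow> ('m, 'f::euclidean_space) chart set \<Rightarrow> ('m \<Rightarrow> 'p) \<Rightarrow>
    'm set \<Rightarrow> ('m \<Rightarrow> 'e) \<Rightarrow> bool" where
  "smooth_along A B \<iota> U Z \<longleftrightarrow> (\<forall>c\<in>A. \<forall>k\<in>B. smooth_on (cmap k ` (U \<inter> cdom k \<inter> \<iota> -` cdom c))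
     (\<lambda>u. comp_in A c (\<iota> (cinv k u)) (Z (cinv k u))))"

text \<open>\<open>sections A B \<iota> E\<close> is \<open>\<Gamma>(E)\<close>.\<close>

definition sections ::
  "('p, 'e::euclidean_space) chart set \<Rightarrow> ('m, 'f::euclidean_space) chart set \<Rightarrow> ('m \<Rightarrow> 'p) \<Rightarrow>
    ('m \<Rightarrow> 'e set) \<Rightarrow> ('m \<Rightarrow> 'e) set" where
  "sections A B \<iota> E = {Z. smooth_along A B \<iota> UNIV Z \<and> (\<forall>p. Z p \<in> E p)}"

definition local_frame ::
  "('p, 'e::euclidean_space) chart set \<Rightarrow> ('m, 'f::euclidean_space) chart set \<Rightarrow> ('m \<Rightarrow> 'p) \<Rightarrow>
    'm set \<Rightarrow> nat \<Rightarrow> (nat \<Rightarrow> 'm \<Rightarrow> 'e) \<Rightarrow> ('m \<Rightarrow> 'e set) \<Rightarrow> bool" where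
  "local_frame A B \<iota> U k s E \<longleftrightarrow> (\<forall>i<k. smooth_along A B \<iota> U (s i)) \<and>
     (\<forall>p\<in>U. inj_on (\<lambda>i. s i p) {..<k} \<and> independent ((\<lambda>i. s i p) ` {..<k}) \<and>
        span ((\<lambda>i. s i p) ` {..<k}) = E p)"

definition subbundle_of_rank ::
  "('p, 'e::euclidean_space) chart set \<Rightarrow> ('m::topological_space, 'f::euclidean_space) chart set \<Rightarrow>
    ('m \<Rightarrow> 'p) \<Rightarrow> nat \<Rightarrow> ('m \<Rightarrow> 'e set) \<Rightarrow> bool" where
  "subbundle_of_rank A B \<iota> k E \<longleftrightarrow> (\<forall>p. \<exists>U s. open U \<and> p \<in> U \<and> local_frame A B \<iota> U k s E)"

definition subbundle ::
  "('p, 'e::euclidean_space) chart set \<Rightarrow> ('m::topological_space, 'f::euclidean_space) chart set \<Rightarrow>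
    ('m \<Rightarrow> 'p) \<Rightarrow> ('m \<Rightarrow> 'e set) \<Rightarrow> bool" where
  "subbundle A B \<iota> E \<longleftrightarrow> (\<exists>k. subbundle_of_rank A B \<iota> k E)"

text \<open>The covariant derivative \<open>\<nabla>\<^sub>X Z\<close> along \<open>\<iota>\<close> induced by an ambient connection: writing
  \<open>Z = z\<^sup>b \<partial>\<^sub>b\<close> in a frame of ambient coordinate fields,
  \<open>\<nabla>\<^sub>X Z = (X z\<^sup>b) \<partial>\<^sub>b + z\<^sup>b \<nabla>\<^sub>X \<partial>\<^sub>b\<close>.\<close>

definition induced_deriv ::
  "('p, 'e::euclidean_space) chart set \<Rightarrow> ('m, 'f::euclidean_space) chart set \<Rightarrow> ('m \<Rightarrow> 'p) \<Rightarrow>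
    ('p \<Rightarrow> 'e \<Rightarrow> ('p \<Rightarrow> 'e) \<Rightarrow> 'e) \<Rightarrow> ('m \<Rightarrow> 'f) \<Rightarrow> ('m \<Rightarrow> 'e) \<Rightarrow> 'm \<Rightarrow> 'e" where
  "induced_deriv A B \<iota> nabla X Z p =
     (let c = chart_at A (\<iota> p); k = chart_at B p; u0 = cmap k p;
          z = (\<lambda>u. comp_in A c (\<iota> (cinv k u)) (Z (cinv k u)))
      in \<Sum>b\<in>Basis. (frechet_derivative z (at u0) (X p) \<bullet> b) *\<^sub>R vec_of A c (\<iota> p) b
           + (z u0 \<bullet> b) *\<^sub>R nabla (\<iota> p) (push A B \<iota> p (X p)) (\<lambda>x. vec_of A c x b))"

definition direct_sum :: "'e::real_vector set \<Rightarrow> 'e set \<Rightarrow> 'e set \<Rightarrow> bool" where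
  "direct_sum E V W \<longleftrightarrow> E = {v + w |v w. v \<in> V \<and> w \<in> W} \<and> V \<inter> W = {0}"

definition orthogonal_sum ::
  "('e::real_vector \<Rightarrow> 'e \<Rightarrow> real) \<Rightarrow> 'e set \<Rightarrow> 'e set \<Rightarrow> 'e set \<Rightarrow> bool" where
  "orthogonal_sum b E V W \<longleftrightarrow> direct_sum E V W \<and> (\<forall>v\<in>V. \<forall>w\<in>W. b v w = 0)"

definition perp :: "('e \<Rightarrow> 'e \<Rightarrow> real) \<Rightarrow> 'e set \<Rightarrow> 'e set" where
  "perp b V = {w. \<forall>v\<in>V. b w v = 0}"

definition tangent ::
  "('p, 'e::euclidean_space) chart set \<Rightarrow> ('m, 'f::euclidean_space) chart set \<Rightarrow> ('m \<Rightarrow> 'p) \<Rightarrow>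
    'm \<Rightarrow> 'e set" where
  "tangent A B \<iota> p = range (push A B \<iota> p)"

definition normal ::
  "('p, 'e::euclidean_space) chart set \<Rightarrow> ('p \<Rightarrow> 'e \<Rightarrow> 'e \<Rightarrow> real) \<Rightarrow>
    ('m, 'f::euclidean_space) chart set \<Rightarrow> ('m \<Rightarrow> 'p) \<Rightarrow> 'm \<Rightarrow> 'e set" where
  "normal A g B \<iota> p = perp (g (\<iota> p)) (tangent A B \<iota> p)"

definition radical ::
  "('p, 'e::euclidean_space) chart set \<Rightarrow> ('p \<Rightarrow> 'e \<Rightarrow> 'e \<Rightarrow> real) \<Rightarrow>
    ('m, 'f::euclidean_space) chart set \<Rightarrow> ('m \<Rightarrow> 'p) \<Rightarrow> 'm \<Rightarrow> 'e set" where
  "radical A g B \<iota> p = tangent A B \<iota> p \<inter> normal A g B \<iota> p"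


section \<open>Lightlike and STCR lightlike submanifolds\<close>

text \<open>\<open>STM\<close>, \<open>STMp\<close> and \<open>ltr\<close> stand for the screen distribution \<open>S(TM)\<close>, the screen transversal
  bundle \<open>S(TM\<^sup>\<bottom>)\<close> and the lightlike transversal bundle \<open>ltr(TM)\<close>.\<close>

locale lightlike_submanifold = semi_riemannian_manifold A g q + immersed_submanifold A B \<iota>
  for A :: "('p::{t2_space, second_countable_topology}, 'e::euclidean_space) chart set"
    and g q
    and B :: "('m::{t2_space, second_countable_topology}, 'f::euclidean_space) chart set"
    and \<iota> +
  fixes r :: nat and STM STMp ltr :: "'m \<Rightarrow> 'e set"
  assumes rank_bounds: "1 \<le> r" "r \<le> DIM('f)"
    and radical_rank: "dim (radical A g B \<iota> p) = r"
    and screen_bundle: "subbundle A B \<iota> STM"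
    and screen_nondegenerate: "nondegenerate_on (g (\<iota> p)) (STM p)"
    and screen_sum: "orthogonal_sum (g (\<iota> p)) (tangent A B \<iota> p) (STM p) (radical A g B \<iota> p)"
    and screen_transversal_bundle: "subbundle A B \<iota> STMp"
    and screen_transversal_nondegenerate: "nondegenerate_on (g (\<iota> p)) (STMp p)"
    and screen_transversal_sum:
      "orthogonal_sum (g (\<iota> p)) (normal A g B \<iota> p) (STMp p) (radical A g B \<iota> p)"
    and ltr_bundle: "subbundle_of_rank A B \<iota> r ltr"
    and ltr_complement: "direct_sum
      (perp (g (\<iota> p)) {v + w |v w. v \<in> STM p \<and> w \<in> STMp p}) (radical A g B \<iota> p) (ltr p)"
    and ltr_frames: "\<exists>U \<xi> N. open U \<and> p \<in> U \<and>
      local_frame A B \<iota> U r \<xi> (radical A g B \<iota>) \<and> local_frame A B \<iota> U r N ltr \<and>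
      (\<forall>x\<in>U. \<forall>i<r. \<forall>j<r. g (\<iota> x) (\<xi> i x) (N j x) = (if i = j then 1 else 0) \<and>
         g (\<iota> x) (N i x) (N j x) = 0)"

text \<open>The components of \<open>\<nabla>\<^sub>X Z\<close> in \<open>ltr(TM)\<close> and \<open>S(TM\<^sup>\<bottom>)\<close> with respect to
  \<open>TM \<oplus> ltr(TM) \<oplus> S(TM\<^sup>\<bottom>)\<close>. The second argument \<open>Z\<close> is a section of \<open>TM\<close>, regarded as a
  section along \<open>\<iota>\<close>, while the direction \<open>X\<close> is a vector field in terms of the atlas \<open>B\<close>.\<close>

definition h_l ::
  "('p, 'e::euclidean_space) chart set \<Rightarrow> ('m, 'f::euclidean_space) chart set \<Rightarrow> ('m \<Rightarrow> 'p) \<Rightarrow>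
    ('p \<Rightarrow> 'e \<Rightarrow> ('p \<Rightarrow> 'e) \<Rightarrow> 'e) \<Rightarrow> ('m \<Rightarrow> 'e set) \<Rightarrow> ('m \<Rightarrow> 'e set) \<Rightarrow>
    ('m \<Rightarrow> 'f) \<Rightarrow> ('m \<Rightarrow> 'e) \<Rightarrow> 'm \<Rightarrow> 'e" where
  "h_l A B \<iota> nabla STMp ltr X Z p = (THE l. l \<in> ltr p \<and>
     (\<exists>t\<in>tangent A B \<iota> p. \<exists>s\<in>STMp p. induced_deriv A B \<iota> nabla X Z p = t + l + s))"

definition h_s ::
  "('p, 'e::euclidean_space) chart set \<Rightarrow> ('m, 'f::euclidean_space) chart set \<Rightarrow> ('m \<Rightarrow> 'p) \<Rightarrow>
    ('p \<Rightarrow> 'e \<Rightarrow> ('p \<Rightarrow> 'e) \<Rightarrow> 'e) \<Rightarrow> ('m \<Rightarrow> 'e set) \<Rightarrow> ('m \<Rightarrow> 'e set) \<Rightarrow>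
    ('m \<Rightarrow> 'f) \<Rightarrow> ('m \<Rightarrow> 'e) \<Rightarrow> 'm \<Rightarrow> 'e" where
  "h_s A B \<iota> nabla STMp ltr X Z p = (THE s. s \<in> STMp p \<and>
     (\<exists>t\<in>tangent A B \<iota> p. \<exists>l\<in>ltr p. induced_deriv A B \<iota> nabla X Z p = t + l + s))"

definition bundle_map :: "('p \<Rightarrow> 'e \<Rightarrow> 'e) \<Rightarrow> ('m \<Rightarrow> 'p) \<Rightarrow> ('m \<Rightarrow> 'e set) \<Rightarrow> 'm \<Rightarrow> 'e set" where
  "bundle_map J \<iota> E p = J (\<iota> p) ` E p"

locale stcr_lightlike_submanifold =
  indefinite_kaehler_manifold A g q nabla J + lightlike_submanifold A g q B \<iota> r STM STMp ltr
  for A :: "('p::{t2_space, second_countable_topology}, 'e::euclidean_space) chart set"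
    and g q nabla J
    and B :: "('m::{t2_space, second_countable_topology}, 'f::euclidean_space) chart set"
    and \<iota> r STM STMp ltr +
  fixes D0 D1 D2 D' L1 L2 S :: "'m \<Rightarrow> 'e set"
  assumes subbundles: "subbundle A B \<iota> D0" "subbundle A B \<iota> D1" "subbundle A B \<iota> D2"
      "subbundle A B \<iota> D'" "subbundle A B \<iota> L1" "subbundle A B \<iota> L2" "subbundle A B \<iota> S"
    and radical_decomp: "direct_sum (radical A g B \<iota> p) (D1 p) (D2 p)"
    and J_D1: "bundle_map J \<iota> D1 p \<subseteq> STM p"
    and J_D2: "bundle_map J \<iota> D2 p \<subseteq> STMp p"
    and screen_decomp: "\<exists>E. direct_sum E (bundle_map J \<iota> D1 p) (D' p) \<and>
      orthogonal_sum (g (\<iota> p)) (STM p) E (D0 p)"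
    and J_D0: "bundle_map J \<iota> D0 p = D0 p"
    and D0_nondegenerate: "nondegenerate_on (g (\<iota> p)) (D0 p)"
    and J_D': "orthogonal_sum (g (\<iota> p)) (bundle_map J \<iota> D' p) (L1 p) (S p)"
    and S_subset: "S p \<subseteq> STMp p"
    and ltr_decomp: "direct_sum (ltr p) (L1 p) (L2 p)"
    and J_L1: "bundle_map J \<iota> L1 p \<subseteq> STM p"
    and J_L2: "bundle_map J \<iota> L2 p \<subseteq> STMp p"
    and screen_transversal_decomp: "\<exists>E. direct_sum E (bundle_map J \<iota> D2 p) (bundle_map J \<iota> L2 p) \<and>
      orthogonal_sum (g (\<iota> p)) (STMp p) E (S p)"

text \<open>\<open>D = D\<^sub>0 \<oplus> D\<^sub>1 \<oplus> J D\<^sub>1\<close>.\<close>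

definition stcr_D ::
  "('p \<Rightarrow> 'e::real_vector \<Rightarrow> 'e) \<Rightarrow> ('m \<Rightarrow> 'p) \<Rightarrow> ('m \<Rightarrow> 'e set) \<Rightarrow> ('m \<Rightarrow> 'e set) \<Rightarrow> 'm \<Rightarrow> 'e set" where
  "stcr_D J \<iota> D0 D1 p = {a + b + c |a b c. a \<in> D0 p \<and> b \<in> D1 p \<and> c \<in> bundle_map J \<iota> D1 p}"

text \<open>The vector fields on the submanifold that belong to \<open>\<Gamma>(D)\<close>, in terms of the atlas \<open>B\<close>.\<close>

definition fields_in ::
  "('p, 'e::euclidean_space) chart set \<Rightarrow> ('m, 'f::euclidean_space) chart set \<Rightarrow> ('m \<Rightarrow> 'p) \<Rightarrow>
    ('m \<Rightarrow> 'e set) \<Rightarrow> ('m \<Rightarrow> 'f) set" where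
  "fields_in A B \<iota> D =
     {X. smooth_vector_field B UNIV X \<and> (\<lambda>p. push A B \<iota> p (X p)) \<in> sections A B \<iota> D}"

text \<open>As is usual in the theory of CR and lightlike submanifolds, \<open>D\<close> is called integrable if
  \<open>[X, Y] \<in> \<Gamma>(D)\<close> for all \<open>X, Y \<in> \<Gamma>(D)\<close>.\<close>

definition integrable_distribution ::
  "('p, 'e::euclidean_space) chart set \<Rightarrow> ('m, 'f::euclidean_space) chart set \<Rightarrow> ('m \<Rightarrow> 'p) \<Rightarrow>
    ('m \<Rightarrow> 'e set) \<Rightarrow> bool" where
  "integrable_distribution A B \<iota> D \<longleftrightarrow>
     (\<forall>X\<in>fields_in A B \<iota> D. \<forall>Y\<in>fields_in A B \<iota> D. lie_bracket B X Y \<in> fields_in A B \<iota> D)"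

end

theory Submission
  imports Defs
begin

text \<open>Since \<open>J\<close> is parallel and the connection torsion free, \<open>\<nabla>\<^sub>X J Y - \<nabla>\<^sub>Y J X = J [X, Y]\<close> along \<open>M\<close>;
  hence the differences of \<open>h\<^sup>l\<close> and \<open>h\<^sup>s\<close> are the \<open>ltr(TM)\<close> and \<open>S(TM\<^sup>\<bottom>)\<close> components of \<open>J [X, Y]\<close>.
  Write a tangent vector as \<open>v = d + d\<^sub>2 + d'\<close> with \<open>d \<in> D\<close>, \<open>d\<^sub>2 \<in> D\<^sub>2\<close>, \<open>d' \<in> D'\<close> and \<open>J d' = l + s\<close>,
  \<open>l \<in> L\<^sub>1\<close>, \<open>s \<in> S\<close>. Then \<open>J d\<close> is tangent, so \<open>J v\<close> has the components \<open>l\<close> and \<open>J d\<^sub>2 + s\<close>. By the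
  directness of \<open>L\<^sub>1 \<oplus> L\<^sub>2\<close> and \<open>J D\<^sub>2 \<oplus> J L\<^sub>2 \<oplus> S\<close>, these lie in \<open>L\<^sub>2\<close> and \<open>J L\<^sub>2\<close> only if
  \<open>l = 0\<close>, \<open>d\<^sub>2 = 0\<close> and \<open>s = 0\<close>, that is, if \<open>v \<in> D\<close>; in that case they vanish.\<close>

section \<open>Smooth maps between Euclidean spaces\<close>

lemma frechet_derivative_eqI:
  "(f has_derivative f') (at x) \<Longrightarrow> frechet_derivative f (at x) = f'"
  using frechet_derivative_at by metis

lemma differentiable_cong_open:
  assumes "open S" "x \<in> S" "\<And>y. y \<in> S \<Longrightarrow> f y = g y" "f differentiable (at x)"
  shows "g differentiable (at x)"
  using assms has_derivative_transform_within_open unfolding differentiable_def by blast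

lemma frechet_derivative_cong_open:
  assumes "open S" "x \<in> S" "\<And>y. y \<in> S \<Longrightarrow> f y = g y"
  shows "frechet_derivative f (at x) = frechet_derivative g (at x)"
proof -
  have "(f has_derivative f') (at x) \<longleftrightarrow> (g has_derivative f') (at x)" for f'
    using assms has_derivative_transform_within_open[of _ f' x UNIV S] by metis
  then show ?thesis by (simp add: frechet_derivative_def)
qed

text \<open>Derivatives in \<open>Ck_on\<close> are taken in the full space, so agreement on
  \<open>S\<close> passes to derivatives only because \<open>S\<close> is a neighbourhood of each of
  its points.\<close>

lemma Ck_on_cong:
  assumes "open S" "\<And>x. x \<in> S \<Longrightarrow> f x = g x" "Ck_on k S f"
  shows "Ck_on k S g"
  using assms(2,3)
proof (induction k arbitrary: f g)
  case 0
  then show ?case by (simp cong: continuous_on_cong)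
next
  case (Suc k)
  have "Ck_on k S (\<lambda>x. frechet_derivative g (at x) v)" for v
  proof (rule Suc.IH)
    show "frechet_derivative f (at x) v = frechet_derivative g (at x) v" if "x \<in> S" for x
      by (rule fun_cong[OF frechet_derivative_cong_open[OF assms(1) that Suc.prems(1)]])
  qed (use Suc.prems in simp)
  moreover have "g differentiable (at x)" if "x \<in> S" for x
    by (rule differentiable_cong_open[OF assms(1) that Suc.prems(1)]) (use Suc.prems that in auto)
  ultimately show ?case by simp
qed

lemma Ck_on_subset: "Ck_on k S f \<Longrightarrow> T \<subseteq> S \<Longrightarrow> Ck_on k T f"
  by (induction k arbitrary: f) (auto intro: continuous_on_subset)

lemma Ck_on_SucD: "Ck_on (Suc k) S f \<Longrightarrow> Ck_on k S f"
proof (induction k arbitrary: f)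
  case 0
  then show ?case
    by (auto intro!: continuous_at_imp_continuous_on differentiable_imp_continuous_within)
next
  case (Suc k)
  then show ?case by (metis Ck_on.simps(2))
qed

lemma Ck_on_const: "Ck_on k S (\<lambda>x. c)"
  by (induction k arbitrary: c) auto

text \<open>Introduction rule for the closure lemmas below: it suffices to exhibit a derivative by a
  formula, without computing \<open>frechet_derivative\<close>.\<close>

lemma Ck_on_SucI:
  assumes "open S" "\<And>x. x \<in> S \<Longrightarrow> (f has_derivative f' x) (at x)"
    and "\<And>v. Ck_on k S (\<lambda>x. f' x v)"
  shows "Ck_on (Suc k) S f"
proof -
  have "Ck_on k S (\<lambda>x. frechet_derivative f (at x) v)" for v
    using assms(1) _ assms(3) by (rule Ck_on_cong) (simp add: frechet_derivative_eqI[OF assms(2)])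
  then show ?thesis using assms(2) by (auto simp: differentiable_def)
qed

lemma Ck_on_Suc_has_derivative:
  "Ck_on (Suc k) S f \<Longrightarrow> x \<in> S \<Longrightarrow> (f has_derivative frechet_derivative f (at x)) (at x)"
  by (simp add: frechet_derivative_works[symmetric])

lemma Ck_on_bounded_linear:
  assumes "open S" "bounded_linear h" "Ck_on k S f"
  shows "Ck_on k S (\<lambda>x. h (f x))"
  using assms(3)
proof (induction k arbitrary: f)
  case 0
  then show ?case using assms(2) by (auto intro: bounded_linear.continuous_on)
next
  case (Suc k)
  show ?case
  proof (rule Ck_on_SucI[OF \<open>open S\<close>])
    show "((\<lambda>x. h (f x)) has_derivative (\<lambda>v. h (frechet_derivative f (at x) v))) (at x)"
      if "x \<in> S" for x
      by (rule bounded_linear.has_derivative[OF assms(2) Ck_on_Suc_has_derivative[OF Suc.prems that]])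
    show "Ck_on k S (\<lambda>x. h (frechet_derivative f (at x) v))" for v
      using Suc by simp
  qed
qed

lemma Ck_on_add:
  assumes "open S" "Ck_on k S f" "Ck_on k S g"
  shows "Ck_on k S (\<lambda>x. f x + g x)"
  using assms(2,3)
proof (induction k arbitrary: f g)
  case 0
  then show ?case by (auto intro: continuous_on_add)
next
  case (Suc k)
  show ?case
  proof (rule Ck_on_SucI[OF \<open>open S\<close>])
    show "((\<lambda>x. f x + g x) has_derivative
        (\<lambda>v. frechet_derivative f (at x) v + frechet_derivative g (at x) v)) (at x)"
      if "x \<in> S" for x
      by (intro has_derivative_add Ck_on_Suc_has_derivative[OF _ that]) fact+
    show "Ck_on k S (\<lambda>x. frechet_derivative f (at x) v + frechet_derivative g (at x) v)" for v
      using Suc by simp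
  qed
qed

text \<open>By the product rule the derivative is a sum of two products of the same kind. In each of
  them one factor is a derivative and the other is undifferentiated, with its order lowered by
  \<open>Ck_on_SucD\<close>; hence the induction over both factors.\<close>

lemma Ck_on_bilinear:
  assumes "open S" "bounded_bilinear h" "Ck_on k S f" "Ck_on k S g"
  shows "Ck_on k S (\<lambda>x. h (f x) (g x))"
  using assms(3,4)
proof (induction k arbitrary: f g)
  case 0
  then show ?case using assms(2) by (auto intro: bounded_bilinear.continuous_on)
next
  case (Suc k)
  note low = Ck_on_SucD[OF Suc.prems(1)] Ck_on_SucD[OF Suc.prems(2)]
  show ?case
  proof (rule Ck_on_SucI[OF \<open>open S\<close>])
    show "((\<lambda>x. h (f x) (g x)) has_derivative
        (\<lambda>v. h (f x) (frechet_derivative g (at x) v) + h (frechet_derivative f (at x) v) (g x))) (at x)"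
      if "x \<in> S" for x
      by (intro bounded_bilinear.FDERIV[OF assms(2)] Ck_on_Suc_has_derivative[OF _ that]) fact+
    show "Ck_on k S (\<lambda>x. h (f x) (frechet_derivative g (at x) v) + h (frechet_derivative f (at x) v) (g x))"
      for v
    proof (rule Ck_on_add[OF \<open>open S\<close>])
      show "Ck_on k S (\<lambda>x. h (f x) (frechet_derivative g (at x) v))"
        by (rule Suc.IH[OF low(1)]) (use Suc.prems(2) in simp)
      show "Ck_on k S (\<lambda>x. h (frechet_derivative f (at x) v) (g x))"
        by (rule Suc.IH[OF _ low(2)]) (use Suc.prems(1) in simp)
    qed
  qed
qed

lemma Ck_on_sum:
  assumes "open S" "\<And>i. i \<in> I \<Longrightarrow> Ck_on k S (f i)"
  shows "Ck_on k S (\<lambda>x. \<Sum>i\<in>I. f i x)"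
  using assms(2)
  by (induction I rule: infinite_finite_induct) (auto intro: Ck_on_add[OF \<open>open S\<close>] Ck_on_const)

text \<open>Reduces a derivative in a varying direction to derivatives in fixed directions, the only
  ones that \<open>Ck_on\<close> speaks of.\<close>

lemma linear_eq_sum_Basis:
  assumes "linear f"
  shows "f v = (\<Sum>b\<in>Basis. (v \<bullet> b) *\<^sub>R f b)"
proof -
  have "f v = f (\<Sum>b\<in>Basis. (v \<bullet> b) *\<^sub>R b)"
    by (simp only: euclidean_representation)
  also have "\<dots> = (\<Sum>b\<in>Basis. (v \<bullet> b) *\<^sub>R f b)"
    by (simp only: linear_sum[OF assms] linear_scale[OF assms] o_def)
  finally show ?thesis .
qed

lemma frechet_derivative_compose_at:
  assumes "f differentiable (at x)" "g differentiable (at (f x))"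
  shows "(g \<circ> f) differentiable (at x)"
    and "frechet_derivative (g \<circ> f) (at x) v =
      frechet_derivative g (at (f x)) (frechet_derivative f (at x) v)"
  using assms by (auto simp: frechet_derivative_compose differentiable_chain_at)

text \<open>In the chain rule the direction fed to the derivative of \<open>g\<close> varies with
  the point. Expanded over \<open>Basis\<close>, it leaves partial derivatives of \<open>g\<close>
  composed with the same \<open>f\<close>, to which the induction hypothesis applies.\<close>

lemma Ck_on_compose:
  fixes f :: "'a::euclidean_space \<Rightarrow> 'b::euclidean_space"
  assumes "open S" "f ` S \<subseteq> T" "Ck_on k S f" "Ck_on k T g"
  shows "Ck_on k S (g \<circ> f)"
  using assms(3,4)
proof (induction k arbitrary: g)
  case 0
  then show ?case using assms(2) unfolding Ck_on.simps
    by (intro continuous_on_compose) (auto intro: continuous_on_subset)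
next
  case (Suc k)
  have diff: "f differentiable (at x)" "g differentiable (at (f x))" if "x \<in> S" for x
    using Suc.prems assms(2) that by auto
  have "Ck_on k S (\<lambda>x. \<Sum>b\<in>Basis. (frechet_derivative f (at x) v \<bullet> b) *\<^sub>R
      ((\<lambda>y. frechet_derivative g (at y) b) \<circ> f) x)" for v
    using Suc.prems
    by (intro Ck_on_sum Ck_on_bilinear[OF _ bounded_bilinear_scaleR] \<open>open S\<close>
        Ck_on_bounded_linear[OF _ bounded_linear_inner_left] Suc.IH[OF Ck_on_SucD])
      (simp_all only: Ck_on.simps(2), blast)
  then have "Ck_on k S (\<lambda>x. frechet_derivative (g \<circ> f) (at x) v)" for v
    by (rule Ck_on_cong[OF \<open>open S\<close>, rotated])
      (simp add: frechet_derivative_compose_at[OF diff]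
        linear_eq_sum_Basis[OF linear_frechet_derivative[OF diff(2)], symmetric])
  moreover have "(g \<circ> f) differentiable (at x)" if "x \<in> S" for x
    by (rule frechet_derivative_compose_at(1)[OF diff[OF that]])
  ultimately show ?case unfolding Ck_on.simps by blast
qed

section \<open>Closure properties of \<open>smooth_on\<close>\<close>

lemma smooth_on_cong: "open S \<Longrightarrow> smooth_on S f \<Longrightarrow> (\<And>x. x \<in> S \<Longrightarrow> f x = g x) \<Longrightarrow> smooth_on S g"
  unfolding smooth_on_def using Ck_on_cong by blast

lemma smooth_on_subset: "smooth_on S f \<Longrightarrow> T \<subseteq> S \<Longrightarrow> smooth_on T f"
  unfolding smooth_on_def using Ck_on_subset by blast

lemma smooth_on_const: "smooth_on S (\<lambda>x. c)"
  unfolding smooth_on_def by (simp add: Ck_on_const)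

lemma smooth_on_bounded_linear:
  "open S \<Longrightarrow> bounded_linear h \<Longrightarrow> smooth_on S f \<Longrightarrow> smooth_on S (\<lambda>x. h (f x))"
  unfolding smooth_on_def by (simp add: Ck_on_bounded_linear)

lemma smooth_on_inner: "open S \<Longrightarrow> smooth_on S f \<Longrightarrow> smooth_on S (\<lambda>x. f x \<bullet> b)"
  by (rule smooth_on_bounded_linear[OF _ bounded_linear_inner_left])

lemma smooth_on_add:
  "open S \<Longrightarrow> smooth_on S f \<Longrightarrow> smooth_on S g \<Longrightarrow> smooth_on S (\<lambda>x. f x + g x)"
  unfolding smooth_on_def by (simp add: Ck_on_add)

lemma smooth_on_scaleR:
  "open S \<Longrightarrow> smooth_on S f \<Longrightarrow> smooth_on S g \<Longrightarrow> smooth_on S (\<lambda>x. f x *\<^sub>R g x)"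
  unfolding smooth_on_def by (simp add: Ck_on_bilinear[OF _ bounded_bilinear_scaleR])

lemma smooth_on_sum:
  "open S \<Longrightarrow> (\<And>i. i \<in> I \<Longrightarrow> smooth_on S (f i)) \<Longrightarrow> smooth_on S (\<lambda>x. \<Sum>i\<in>I. f i x)"
  unfolding smooth_on_def by (simp add: Ck_on_sum)

lemma smooth_on_compose:
  fixes f :: "'a::euclidean_space \<Rightarrow> 'b::euclidean_space"
  shows "open S \<Longrightarrow> f ` S \<subseteq> T \<Longrightarrow> smooth_on S f \<Longrightarrow> smooth_on T g \<Longrightarrow> smooth_on S (g \<circ> f)"
  unfolding smooth_on_def by (simp add: Ck_on_compose)

lemma smooth_on_differentiable: "smooth_on S f \<Longrightarrow> x \<in> S \<Longrightarrow> f differentiable (at x)"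
  unfolding smooth_on_def by (metis Ck_on.simps(2))

lemma smooth_on_derivative: "smooth_on S f \<Longrightarrow> smooth_on S (\<lambda>x. frechet_derivative f (at x) v)"
  unfolding smooth_on_def by (metis Ck_on.simps(2))

lemma smooth_on_derivative_field:
  fixes f :: "'a::euclidean_space \<Rightarrow> 'b::real_normed_vector"
  assumes "open S" "smooth_on S f" "smooth_on S v"
  shows "smooth_on S (\<lambda>x. frechet_derivative f (at x) (v x))"
proof (rule smooth_on_cong[OF \<open>open S\<close>])
  show "smooth_on S (\<lambda>x. \<Sum>b\<in>Basis. (v x \<bullet> b) *\<^sub>R frechet_derivative f (at x) b)"
    using assms by (intro smooth_on_sum smooth_on_scaleR smooth_on_inner smooth_on_derivative)
next
  fix x assume "x \<in> S"
  then show "(\<Sum>b\<in>Basis. (v x \<bullet> b) *\<^sub>R frechet_derivative f (at x) b)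
      = frechet_derivative f (at x) (v x)"
    using smooth_on_differentiable[OF assms(2)] linear_eq_sum_Basis[OF linear_frechet_derivative]
    by metis
qed

section \<open>Symmetry of second derivatives\<close>

text \<open>The mean value theorem is applied twice: along \<open>v\<close> to the difference of
  \<open>f\<close> and its translate by \<open>t *\<^sub>R w\<close>, then along \<open>w\<close> to
  the derivative of \<open>f\<close> in direction \<open>v\<close>.\<close>

lemma second_difference_mvt:
  fixes f :: "'a::euclidean_space \<Rightarrow> real"
  assumes "0 < t" and f: "smooth_on S f"
    and sub: "\<And>s s'. s \<in> {0..t} \<Longrightarrow> s' \<in> {0..t} \<Longrightarrow> x + s *\<^sub>R v + s' *\<^sub>R w \<in> S"
  shows "\<exists>s\<in>{0..t}. \<exists>s'\<in>{0..t}.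
    f (x + t *\<^sub>R v + t *\<^sub>R w) - f (x + t *\<^sub>R v) - f (x + t *\<^sub>R w) + f x =
    t * t * frechet_derivative (\<lambda>y. frechet_derivative f (at y) v) (at (x + s *\<^sub>R v + s' *\<^sub>R w)) w"
proof -
  define h where "h y = frechet_derivative f (at y) v" for y
  have h: "smooth_on S h"
    unfolding h_def by (rule smooth_on_derivative[OF f])
  have line: "((\<lambda>s. k (y + s *\<^sub>R u)) has_derivative
      (\<lambda>c. c * frechet_derivative k (at (y + s *\<^sub>R u)) u)) (at s within T)"
    if "smooth_on S k" "y + s *\<^sub>R u \<in> S" for k :: "'a \<Rightarrow> real" and y u s T
  proof -
    have d: "k differentiable (at (y + s *\<^sub>R u))"
      using that by (rule smooth_on_differentiable)
    then have "(k has_derivative frechet_derivative k (at (y + s *\<^sub>R u))) (at (y + s *\<^sub>R u))"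
      by (simp add: frechet_derivative_works)
    then have "((\<lambda>s. k (y + s *\<^sub>R u)) has_derivative
        (\<lambda>c. frechet_derivative k (at (y + s *\<^sub>R u)) (c *\<^sub>R u))) (at s within T)"
      by (rule has_derivative_compose[rotated]) (auto intro!: derivative_eq_intros)
    then show ?thesis
      using linear_scale[OF linear_frechet_derivative[OF d]] by simp
  qed
  have sub0: "x + s *\<^sub>R v \<in> S" if "s \<in> {0..t}" for s
    using sub[OF that, of 0] \<open>0 < t\<close> by simp
  have sub1: "x + t *\<^sub>R w + s *\<^sub>R v \<in> S" if "s \<in> {0..t}" for s
    using sub[OF that, of t] \<open>0 < t\<close> by (simp add: algebra_simps)
  have "\<exists>s\<in>{0..t}. (f (x + t *\<^sub>R w + t *\<^sub>R v) - f (x + t *\<^sub>R v)) - (f (x + t *\<^sub>R w + 0 *\<^sub>R v) - f (x + 0 *\<^sub>R v))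
      = (t - 0) * h (x + t *\<^sub>R w + s *\<^sub>R v) - (t - 0) * h (x + s *\<^sub>R v)"
    using \<open>0 < t\<close> unfolding h_def
    by (intro mvt_very_simple has_derivative_diff line[OF f] sub0 sub1) auto
  then obtain s where s: "s \<in> {0..t}" and eq1:
    "(f (x + t *\<^sub>R w + t *\<^sub>R v) - f (x + t *\<^sub>R v)) - (f (x + t *\<^sub>R w) - f x)
      = t * (h (x + t *\<^sub>R w + s *\<^sub>R v) - h (x + s *\<^sub>R v))"
    by (auto simp: algebra_simps)
  have "\<exists>s'\<in>{0..t}. h (x + s *\<^sub>R v + t *\<^sub>R w) - h (x + s *\<^sub>R v + 0 *\<^sub>R w)
      = (t - 0) * frechet_derivative h (at (x + s *\<^sub>R v + s' *\<^sub>R w)) w"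
    using \<open>0 < t\<close> by (intro mvt_very_simple line[OF h] sub[OF s]) auto
  then obtain s' where s': "s' \<in> {0..t}" and eq2:
    "h (x + s *\<^sub>R v + t *\<^sub>R w) - h (x + s *\<^sub>R v)
      = t * frechet_derivative h (at (x + s *\<^sub>R v + s' *\<^sub>R w)) w"
    by auto
  have "x + t *\<^sub>R w + s *\<^sub>R v = x + s *\<^sub>R v + t *\<^sub>R w" "x + t *\<^sub>R w + t *\<^sub>R v = x + t *\<^sub>R v + t *\<^sub>R w"
    by (simp_all add: algebra_simps)
  with eq1 eq2 have "f (x + t *\<^sub>R v + t *\<^sub>R w) - f (x + t *\<^sub>R v) - f (x + t *\<^sub>R w) + f x =
    t * t * frechet_derivative h (at (x + s *\<^sub>R v + s' *\<^sub>R w)) w"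
    by (simp add: algebra_simps)
  with s s' show ?thesis unfolding h_def by blast
qed

text \<open>The second difference is symmetric in \<open>v\<close> and \<open>w\<close>. By the
  previous lemma it equals \<open>t * t\<close> times either mixed derivative at some nearby point,
  so continuity prevents the two from differing at \<open>x\<close>.\<close>

lemma symmetric_second_derivative_real:
  fixes f :: "'a::euclidean_space \<Rightarrow> real"
  assumes "open S" "smooth_on S f" "x \<in> S"
  shows "frechet_derivative (\<lambda>y. frechet_derivative f (at y) v) (at x) w =
    frechet_derivative (\<lambda>y. frechet_derivative f (at y) w) (at x) v"
proof (rule ccontr)
  define G where "G v w y = frechet_derivative (\<lambda>y. frechet_derivative f (at y) v) (at y) w" for v w y
  assume "\<not> ?thesis"
  \<comment> \<open>Half the distance, so that two errors below this bound cannot bridge the gap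
    between the two mixed derivatives.\<close>
  then have e: "0 < dist (G v w x) (G w v x) / 2" (is "0 < ?e")
    by (simp add: G_def)
  have cont: "continuous_on S (G v w)" for v w
    using smooth_on_derivative[OF smooth_on_derivative[OF assms(2)]]
    unfolding G_def smooth_on_def by (metis Ck_on.simps(1))
  then have "isCont (G v w) x" for v w
    using assms by (simp add: continuous_on_eq_continuous_at)
  then have "\<exists>d>0. \<forall>y. dist y x < d \<longrightarrow> dist (G v w y) (G v w x) < ?e" for v w
    using e unfolding continuous_at_eps_delta by blast
  then obtain d1 d2 where d1: "d1 > 0" "\<And>y. dist y x < d1 \<Longrightarrow> dist (G v w y) (G v w x) < ?e"
    and d2: "d2 > 0" "\<And>y. dist y x < d2 \<Longrightarrow> dist (G w v y) (G w v x) < ?e"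
    by metis
  obtain d3 where d3: "d3 > 0" "ball x d3 \<subseteq> S"
    using assms open_contains_ball by blast
  define d where "d = min d1 (min d2 d3)"
  have d: "d > 0" using d1 d2 d3 by (simp add: d_def)
  \<comment> \<open>The parallelogram with sides \<open>t *\<^sub>R v\<close> and
    \<open>t *\<^sub>R w\<close> stays within distance \<open>d\<close> of \<open>x\<close>. The
    summand 1 keeps the denominator positive when both vectors are zero.\<close>
  define t where "t = d / (norm v + norm w + 1)"
  have n: "norm v + norm w + 1 > 0" by (simp add: add_nonneg_pos)
  have t: "t > 0" using d n by (simp add: t_def)
  have td: "t * (norm v + norm w) < d"
  proof -
    have "t * (norm v + norm w) < t * (norm v + norm w + 1)" using t by simp
    also have "\<dots> = d" using n by (simp add: t_def)
    finally show ?thesis .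
  qed
  have near: "dist (x + s *\<^sub>R v + s' *\<^sub>R w) x < d" if "s \<in> {0..t}" "s' \<in> {0..t}" for s s'
  proof -
    have "dist (x + s *\<^sub>R v + s' *\<^sub>R w) x = norm (s *\<^sub>R v + s' *\<^sub>R w)"
      by (simp add: dist_norm algebra_simps)
    also have "\<dots> \<le> s * norm v + s' * norm w"
      using that by (intro order_trans[OF norm_triangle_ineq]) simp
    also have "\<dots> \<le> t * norm v + t * norm w"
      using that by (intro add_mono mult_right_mono) auto
    finally show ?thesis using td by (simp add: algebra_simps)
  qed
  have sub: "x + s *\<^sub>R v + s' *\<^sub>R w \<in> S" if "s \<in> {0..t}" "s' \<in> {0..t}" for s s'
  proof -
    have "dist x (x + s *\<^sub>R v + s' *\<^sub>R w) < d3"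
      using near[OF that] by (simp add: d_def dist_commute)
    then show ?thesis using d3(2) by auto
  qed
  obtain s s' where s: "s \<in> {0..t}" "s' \<in> {0..t}" and eq1:
    "f (x + t *\<^sub>R v + t *\<^sub>R w) - f (x + t *\<^sub>R v) - f (x + t *\<^sub>R w) + f x
      = t * t * G v w (x + s *\<^sub>R v + s' *\<^sub>R w)"
    using second_difference_mvt[OF t assms(2) sub] unfolding G_def by blast
  have sub': "x + s *\<^sub>R w + s' *\<^sub>R v \<in> S" if "s \<in> {0..t}" "s' \<in> {0..t}" for s s'
    using sub[OF that(2,1)] by (simp add: algebra_simps)
  obtain r r' where r: "r \<in> {0..t}" "r' \<in> {0..t}" and eq2:
    "f (x + t *\<^sub>R w + t *\<^sub>R v) - f (x + t *\<^sub>R w) - f (x + t *\<^sub>R v) + f x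
      = t * t * G w v (x + r *\<^sub>R w + r' *\<^sub>R v)"
    using second_difference_mvt[OF t assms(2) sub'] unfolding G_def by blast
  have "x + t *\<^sub>R w + t *\<^sub>R v = x + t *\<^sub>R v + t *\<^sub>R w"
    by (simp add: algebra_simps)
  with eq1 eq2 have "t * (t * G v w (x + s *\<^sub>R v + s' *\<^sub>R w)) = t * (t * G w v (x + r *\<^sub>R w + r' *\<^sub>R v))"
    by (simp only: mult.assoc)
  then have eq: "G v w (x + s *\<^sub>R v + s' *\<^sub>R w) = G w v (x + r *\<^sub>R w + r' *\<^sub>R v)"
    using t by simp
  have "dist (G v w (x + s *\<^sub>R v + s' *\<^sub>R w)) (G v w x) < ?e"
    by (rule d1(2)) (use near[OF s] in \<open>simp add: d_def\<close>)
  moreover have "dist (G w v (x + r *\<^sub>R w + r' *\<^sub>R v)) (G w v x) < ?e"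
    by (rule d2(2)) (use near[OF r(2,1)] in \<open>simp add: d_def algebra_simps\<close>)
  ultimately show False
    using eq dist_triangle_half_r by (metis less_irrefl)
qed

lemma frechet_derivative_inner:
  assumes "f differentiable (at x)"
  shows "frechet_derivative (\<lambda>y. f y \<bullet> b) (at x) v = frechet_derivative f (at x) v \<bullet> b"
  using assms by (intro fun_cong[OF frechet_derivative_eqI])
    (auto intro!: has_derivative_inner_left simp: frechet_derivative_works)

lemma symmetric_second_derivative:
  fixes f :: "'a::euclidean_space \<Rightarrow> 'b::euclidean_space"
  assumes "open S" "smooth_on S f" "x \<in> S"
  shows "frechet_derivative (\<lambda>y. frechet_derivative f (at y) v) (at x) w =
    frechet_derivative (\<lambda>y. frechet_derivative f (at y) w) (at x) v"
proof (rule euclidean_eqI)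
  fix b :: 'b
  have *: "frechet_derivative (\<lambda>y. frechet_derivative f (at y) v) (at x) w \<bullet> b =
    frechet_derivative (\<lambda>y. frechet_derivative (\<lambda>z. f z \<bullet> b) (at y) v) (at x) w" for v w
  proof -
    have "frechet_derivative (\<lambda>y. frechet_derivative f (at y) v) (at x) w \<bullet> b
        = frechet_derivative (\<lambda>y. frechet_derivative f (at y) v \<bullet> b) (at x) w"
      by (rule frechet_derivative_inner[symmetric, OF smooth_on_differentiable[OF
              smooth_on_derivative[OF assms(2)] assms(3)]])
    also have "frechet_derivative (\<lambda>y. frechet_derivative f (at y) v \<bullet> b) (at x)
        = frechet_derivative (\<lambda>y. frechet_derivative (\<lambda>z. f z \<bullet> b) (at y) v) (at x)"
      by (rule frechet_derivative_cong_open[OF assms(1,3)])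
        (simp add: frechet_derivative_inner[OF smooth_on_differentiable[OF assms(2)]])
    finally show ?thesis .
  qed
  show "frechet_derivative (\<lambda>y. frechet_derivative f (at y) v) (at x) w \<bullet> b =
    frechet_derivative (\<lambda>y. frechet_derivative f (at y) w) (at x) v \<bullet> b"
    using symmetric_second_derivative_real[OF assms(1) smooth_on_inner[OF assms(1,2)] assms(3)]
    by (simp add: *)
qed

text \<open>Product rule for a derivative applied to a moving vector. The expansion over
  \<open>Basis\<close> makes it a sum of ordinary products, with no derivative of an operator-valued
  map.\<close>

lemma frechet_derivative_of_derivative_field:
  fixes \<phi> :: "'a::euclidean_space \<Rightarrow> 'b::euclidean_space"
  assumes "open S" "smooth_on S \<phi>" "x \<in> S" and y: "y differentiable (at x)"
  shows "((\<lambda>u. frechet_derivative \<phi> (at u) (y u)) has_derivative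
      (\<lambda>w. frechet_derivative (\<lambda>u. frechet_derivative \<phi> (at u) (y x)) (at x) w
        + frechet_derivative \<phi> (at x) (frechet_derivative y (at x) w))) (at x)"
proof -
  let ?D = "\<lambda>u. frechet_derivative \<phi> (at u)"
  let ?y' = "frechet_derivative y (at x)"
  have lin: "linear (?D u)" if "u \<in> S" for u
    using smooth_on_differentiable[OF assms(2) that] by (rule linear_frechet_derivative)
  have dD: "((\<lambda>u. ?D u b) has_derivative frechet_derivative (\<lambda>u. ?D u b) (at x)) (at x)" for b
    using smooth_on_differentiable[OF smooth_on_derivative[OF assms(2)] assms(3)]
    by (simp add: frechet_derivative_works)
  have dy: "(y has_derivative ?y') (at x)"
    using y by (simp add: frechet_derivative_works)
  have sum_eq: "((\<lambda>u. \<Sum>b\<in>Basis. (y u \<bullet> b) *\<^sub>R ?D u b) has_derivative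
     (\<lambda>w. \<Sum>b\<in>Basis. (y x \<bullet> b) *\<^sub>R frechet_derivative (\<lambda>u. ?D u b) (at x) w + (?y' w \<bullet> b) *\<^sub>R ?D x b)) (at x)"
    by (intro has_derivative_sum has_derivative_scaleR has_derivative_inner_left dy dD)
  \<comment> \<open>With the coefficients frozen at \<open>y x\<close>, the sum is the derivative of
    \<phi> in a constant direction; this identifies the Hessian term.\<close>
  have "((\<lambda>u. \<Sum>b\<in>Basis. (y x \<bullet> b) *\<^sub>R ?D u b) has_derivative
     (\<lambda>w. \<Sum>b\<in>Basis. (y x \<bullet> b) *\<^sub>R frechet_derivative (\<lambda>u. ?D u b) (at x) w)) (at x)"
    by (intro has_derivative_sum has_derivative_scaleR_right dD)
  then have "((\<lambda>u. ?D u (y x)) has_derivative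
     (\<lambda>w. \<Sum>b\<in>Basis. (y x \<bullet> b) *\<^sub>R frechet_derivative (\<lambda>u. ?D u b) (at x) w)) (at x)"
    by (rule has_derivative_transform_within_open[OF _ assms(1,3)])
      (simp add: linear_eq_sum_Basis[OF lin, symmetric])
  then have D2: "(\<Sum>b\<in>Basis. (y x \<bullet> b) *\<^sub>R frechet_derivative (\<lambda>u. ?D u b) (at x) w)
      = frechet_derivative (\<lambda>u. ?D u (y x)) (at x) w" for w
    by (simp add: frechet_derivative_eqI)
  have "((\<lambda>u. ?D u (y u)) has_derivative
     (\<lambda>w. \<Sum>b\<in>Basis. (y x \<bullet> b) *\<^sub>R frechet_derivative (\<lambda>u. ?D u b) (at x) w + (?y' w \<bullet> b) *\<^sub>R ?D x b)) (at x)"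
    by (rule has_derivative_transform_within_open[OF sum_eq assms(1,3)])
      (simp add: linear_eq_sum_Basis[OF lin, symmetric])
  then show ?thesis
    by (simp add: sum.distrib D2 linear_eq_sum_Basis[OF lin[OF assms(3)], symmetric])
qed

text \<open>The Hessian of \<open>\<phi>\<close> cancels; this is the naturality of the Lie bracket, and the reason why the
  covariant derivative along an immersion is torsion free.\<close>

lemma derivative_field_antisym:
  fixes \<phi> :: "'a::euclidean_space \<Rightarrow> 'b::euclidean_space"
  assumes "open S" "smooth_on S \<phi>" "u \<in> S"
    and "x differentiable (at u)" "y differentiable (at u)"
  shows "frechet_derivative (\<lambda>u. frechet_derivative \<phi> (at u) (y u)) (at u) (x u) -
      frechet_derivative (\<lambda>u. frechet_derivative \<phi> (at u) (x u)) (at u) (y u) =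
    frechet_derivative \<phi> (at u) (frechet_derivative y (at u) (x u) - frechet_derivative x (at u) (y u))"
proof -
  note D = frechet_derivative_eqI[OF frechet_derivative_of_derivative_field[OF assms(1-3)]]
  show ?thesis
    unfolding D[OF assms(4)] D[OF assms(5)]
      linear_diff[OF linear_frechet_derivative[OF smooth_on_differentiable[OF assms(2,3)]]]
      symmetric_second_derivative[OF assms(1-3), of "x u" "y u"]
    by simp
qed

text \<open>The derivative of each field along \<phi> is computed twice, by the chain rule and from
  the relation \<open>rel\<close>; \<open>derivative_field_antisym\<close> then applies. With a
  transition map as \<phi> this makes the Lie bracket independent of the chart.\<close>

lemma related_fields_bracket:
  fixes \<phi> :: "'a::euclidean_space \<Rightarrow> 'b::euclidean_space"
  assumes S: "open S" "smooth_on S \<phi>" "u \<in> S"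
    and xy: "x differentiable (at u)" "y differentiable (at u)"
    and XY: "X differentiable (at (\<phi> u))" "Y differentiable (at (\<phi> u))"
    and rel: "\<And>w. w \<in> S \<Longrightarrow> X (\<phi> w) = frechet_derivative \<phi> (at w) (x w)"
      "\<And>w. w \<in> S \<Longrightarrow> Y (\<phi> w) = frechet_derivative \<phi> (at w) (y w)"
  shows "frechet_derivative Y (at (\<phi> u)) (X (\<phi> u)) - frechet_derivative X (at (\<phi> u)) (Y (\<phi> u)) =
    frechet_derivative \<phi> (at u) (frechet_derivative y (at u) (x u) - frechet_derivative x (at u) (y u))"
proof -
  have *: "frechet_derivative Z (at (\<phi> u)) (frechet_derivative \<phi> (at u) w) =
      frechet_derivative (\<lambda>v. frechet_derivative \<phi> (at v) (z v)) (at u) w"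
    if "Z differentiable (at (\<phi> u))" "\<And>w. w \<in> S \<Longrightarrow> Z (\<phi> w) = frechet_derivative \<phi> (at w) (z w)"
    for Z z w
  proof -
    have "frechet_derivative Z (at (\<phi> u)) (frechet_derivative \<phi> (at u) w)
        = frechet_derivative (Z \<circ> \<phi>) (at u) w"
      by (rule frechet_derivative_compose_at(2)[OF smooth_on_differentiable[OF S(2,3)] that(1), symmetric])
    also have "frechet_derivative (Z \<circ> \<phi>) (at u)
        = frechet_derivative (\<lambda>v. frechet_derivative \<phi> (at v) (z v)) (at u)"
      by (rule frechet_derivative_cong_open[OF S(1,3)]) (simp add: that(2))
    finally show ?thesis .
  qed
  show ?thesis
    using derivative_field_antisym[OF S xy] *[OF XY(1) rel(1)] *[OF XY(2) rel(2)]
    by (simp add: rel[OF S(3)])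
qed

section \<open>Charts, tangent vectors and vector fields\<close>

abbreviation in_chart ::
  "('p, 'e::euclidean_space) chart set \<Rightarrow> ('p, 'e) chart \<Rightarrow> ('p \<Rightarrow> 'e) \<Rightarrow> 'e \<Rightarrow> 'e" where
  "in_chart A c X \<equiv> \<lambda>z. comp_in A c (cinv c z) (X (cinv c z))"

abbreviation coord_field ::
  "('p, 'e::euclidean_space) chart set \<Rightarrow> ('p, 'e) chart \<Rightarrow> 'e \<Rightarrow> 'p \<Rightarrow> 'e" where
  "coord_field A c a \<equiv> \<lambda>x. vec_of A c x a"

context smooth_manifold
begin

section \<open>Charts and transition maps\<close>

lemma chart_at: "chart_at A p \<in> A" "p \<in> cdom (chart_at A p)"
proof -
  have "\<exists>c. c \<in> A \<and> p \<in> cdom c" using cover UNIV_I by (metis UN_E)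
  then have "chart_at A p \<in> A \<and> p \<in> cdom (chart_at A p)"
    unfolding chart_at_def by (rule someI_ex)
  then show "chart_at A p \<in> A" "p \<in> cdom (chart_at A p)" by auto
qed

lemma cinv_cmap: "c \<in> A \<Longrightarrow> p \<in> cdom c \<Longrightarrow> cinv c (cmap c p) = p"
  using charts homeomorphism_apply1 by metis

lemma open_cdom: "c \<in> A \<Longrightarrow> open (cdom c)"
  using charts by blast

text \<open>A homeomorphism is open relative to its image, and the image of a chart is itself
  open.\<close>

lemma open_chart_image:
  assumes "c \<in> A" "open V"
  shows "open (cmap c ` (V \<inter> cdom c))"
proof -
  have "openin (top_of_set (cdom c)) (V \<inter> cdom c)"
    by (subst Int_commute) (rule openin_open_Int[OF assms(2)])
  then have "openin (top_of_set (cmap c ` cdom c)) (cmap c ` (V \<inter> cdom c))"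
    using homeomorphism_imp_open_map charts[OF assms(1)] by metis
  then show ?thesis using charts[OF assms(1)] openin_open_eq by metis
qed

lemma open_chart_image': "c \<in> A \<Longrightarrow> open V \<Longrightarrow> open (cmap c ` (cdom c \<inter> V))"
  using open_chart_image by (simp add: Int_commute)

text \<open>On the overlap, \<open>f \<circ> cinv c\<close> factors through the transition map, so
  this is the chain rule. A coordinate map as \<open>f\<close> gives the cocycle rule
  \<open>transition_trans\<close>; the composite of a coordinate map with an immersion is needed in
  \<open>push_in_chart\<close>.\<close>

lemma change_of_chart:
  fixes f :: "'p \<Rightarrow> 'b::real_normed_vector"
  assumes c: "c \<in> A" "p \<in> cdom c" and d: "d \<in> A" "p \<in> cdom d"
    and f: "(f \<circ> cinv d) differentiable (at (cmap d p))"
  shows "(f \<circ> cinv c) differentiable (at (cmap c p))"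
    and "frechet_derivative (f \<circ> cinv c) (at (cmap c p)) v = frechet_derivative (f \<circ> cinv d)
      (at (cmap d p)) (frechet_derivative (cmap d \<circ> cinv c) (at (cmap c p)) v)"
proof -
  let ?S = "cmap c ` (cdom c \<inter> cdom d)"
  have S: "open ?S" "cmap c p \<in> ?S"
    using open_chart_image'[OF c(1) open_cdom[OF d(1)]] c d by auto
  have diff: "(cmap d \<circ> cinv c) differentiable (at (cmap c p))"
    using smooth_on_differentiable[OF compatible[OF c(1) d(1)] S(2)] .
  have cp: "(cmap d \<circ> cinv c) (cmap c p) = cmap d p"
    by (simp add: cinv_cmap[OF c])
  then have f': "(f \<circ> cinv d) differentiable (at ((cmap d \<circ> cinv c) (cmap c p)))"
    using f by simp
  have eq: "((f \<circ> cinv d) \<circ> (cmap d \<circ> cinv c)) u = (f \<circ> cinv c) u" if "u \<in> ?S" for u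
    using that c d by (auto simp: cinv_cmap)
  show "(f \<circ> cinv c) differentiable (at (cmap c p))"
    using differentiable_cong_open[OF S eq frechet_derivative_compose_at(1)[OF diff f']] .
  show "frechet_derivative (f \<circ> cinv c) (at (cmap c p)) v = frechet_derivative (f \<circ> cinv d)
      (at (cmap d p)) (frechet_derivative (cmap d \<circ> cinv c) (at (cmap c p)) v)"
  proof -
    have "frechet_derivative ((f \<circ> cinv d) \<circ> (cmap d \<circ> cinv c)) (at (cmap c p)) =
        frechet_derivative (f \<circ> cinv c) (at (cmap c p))"
      by (rule frechet_derivative_cong_open[OF S eq])
    then show ?thesis
      using frechet_derivative_compose_at(2)[OF diff f', of v] unfolding cp by metis
  qed
qed

lemma transition_differentiable:
  "c \<in> A \<Longrightarrow> d \<in> A \<Longrightarrow> p \<in> cdom c \<Longrightarrow> p \<in> cdom d \<Longrightarrow> (cmap d \<circ> cinv c) differentiable (at (cmap c p))"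
  by (rule smooth_on_differentiable[OF compatible]) auto

lemma transition_linear:
  "c \<in> A \<Longrightarrow> d \<in> A \<Longrightarrow> p \<in> cdom c \<Longrightarrow> p \<in> cdom d \<Longrightarrow>
    linear (frechet_derivative (cmap d \<circ> cinv c) (at (cmap c p)))"
  by (rule linear_frechet_derivative[OF transition_differentiable])

lemma transition_trans:
  "c \<in> A \<Longrightarrow> d \<in> A \<Longrightarrow> e \<in> A \<Longrightarrow> p \<in> cdom c \<Longrightarrow> p \<in> cdom d \<Longrightarrow> p \<in> cdom e \<Longrightarrow>
    frechet_derivative (cmap e \<circ> cinv d) (at (cmap d p))
      (frechet_derivative (cmap d \<circ> cinv c) (at (cmap c p)) v) =
    frechet_derivative (cmap e \<circ> cinv c) (at (cmap c p)) v"
  by (rule change_of_chart(2)[symmetric]) (auto intro: transition_differentiable)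

lemma transition_self:
  assumes "c \<in> A" "p \<in> cdom c"
  shows "frechet_derivative (cmap c \<circ> cinv c) (at (cmap c p)) v = v"
proof -
  have "frechet_derivative (cmap c \<circ> cinv c) (at (cmap c p)) = frechet_derivative (\<lambda>x. x) (at (cmap c p))"
    by (rule frechet_derivative_cong_open[of "cmap c ` cdom c"])
      (use charts[OF assms(1)] assms in \<open>auto simp: cinv_cmap\<close>)
  then show ?thesis by simp
qed

section \<open>Components of tangent vectors\<close>

lemma comp_in_linear: "c \<in> A \<Longrightarrow> p \<in> cdom c \<Longrightarrow> linear (comp_in A c p)"
  unfolding comp_in_def[abs_def] by (intro transition_linear chart_at)

lemma comp_in_chart_at: "comp_in A (chart_at A p) p v = v"
  unfolding comp_in_def by (intro transition_self chart_at)

lemma vec_of_chart_at: "vec_of A (chart_at A p) p v = v"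
  unfolding vec_of_def by (intro transition_self chart_at)

text \<open>Both maps pass through the chart chosen at \<open>p\<close>, which drops out by the
  cocycle rule.\<close>

lemma comp_in_vec_of_change:
  "c \<in> A \<Longrightarrow> p \<in> cdom c \<Longrightarrow> d \<in> A \<Longrightarrow> p \<in> cdom d \<Longrightarrow>
    comp_in A d p (vec_of A c p a) = frechet_derivative (cmap d \<circ> cinv c) (at (cmap c p)) a"
  unfolding vec_of_def comp_in_def by (intro transition_trans chart_at)

lemma comp_in_vec_of: "c \<in> A \<Longrightarrow> p \<in> cdom c \<Longrightarrow> comp_in A c p (vec_of A c p a) = a"
  by (simp add: comp_in_vec_of_change transition_self)

lemma vec_of_comp_in:
  assumes "c \<in> A" "p \<in> cdom c"
  shows "vec_of A c p (comp_in A c p v) = v"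
proof -
  have "vec_of A c p (comp_in A c p v)
      = frechet_derivative (cmap (chart_at A p) \<circ> cinv (chart_at A p)) (at (cmap (chart_at A p) p)) v"
    unfolding vec_of_def comp_in_def by (intro transition_trans chart_at assms)
  then show ?thesis by (simp add: transition_self chart_at)
qed

lemma vec_of_linear: "c \<in> A \<Longrightarrow> p \<in> cdom c \<Longrightarrow> linear (vec_of A c p)"
  unfolding vec_of_def[abs_def] by (intro transition_linear chart_at)

lemma comp_in_change:
  "c \<in> A \<Longrightarrow> p \<in> cdom c \<Longrightarrow> d \<in> A \<Longrightarrow> p \<in> cdom d \<Longrightarrow>
    comp_in A d p v = frechet_derivative (cmap d \<circ> cinv c) (at (cmap c p)) (comp_in A c p v)"
  using comp_in_vec_of_change[of c p d "comp_in A c p v"] by (simp add: vec_of_comp_in)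

section \<open>Smooth vector fields\<close>

lemma smooth_vector_field_cong:
  assumes "open U" "smooth_vector_field A U X" "\<And>x. x \<in> U \<Longrightarrow> X x = Y x"
  shows "smooth_vector_field A U Y"
  unfolding smooth_vector_field_def
proof
  fix c assume c: "c \<in> A"
  show "smooth_on (cmap c ` (U \<inter> cdom c)) (in_chart A c Y)"
    by (rule smooth_on_cong[OF open_chart_image[OF c assms(1)], of "in_chart A c X"])
      (use assms c in \<open>auto simp: smooth_vector_field_def cinv_cmap\<close>)
qed

lemma smooth_vector_field_add:
  assumes "open U" "smooth_vector_field A U X" "smooth_vector_field A U Y"
  shows "smooth_vector_field A U (\<lambda>x. X x + Y x)"
  unfolding smooth_vector_field_def
proof
  fix c assume c: "c \<in> A"
  show "smooth_on (cmap c ` (U \<inter> cdom c)) (in_chart A c (\<lambda>x. X x + Y x))"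
    by (rule smooth_on_cong[OF open_chart_image[OF c assms(1)]
          smooth_on_add[OF open_chart_image[OF c assms(1)], of "in_chart A c X" "in_chart A c Y"]])
      (use assms c in \<open>auto simp: smooth_vector_field_def cinv_cmap linear_add[OF comp_in_linear]\<close>)
qed

lemma smooth_vector_field_scaleR:
  assumes "open U" "smooth_function A U f" "smooth_vector_field A U X"
  shows "smooth_vector_field A U (\<lambda>x. f x *\<^sub>R X x)"
  unfolding smooth_vector_field_def
proof
  fix c assume c: "c \<in> A"
  show "smooth_on (cmap c ` (U \<inter> cdom c)) (in_chart A c (\<lambda>x. f x *\<^sub>R X x))"
    by (rule smooth_on_cong[OF open_chart_image[OF c assms(1)]
          smooth_on_scaleR[OF open_chart_image[OF c assms(1)], of "f \<circ> cinv c" "in_chart A c X"]])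
      (use assms c in \<open>auto simp: smooth_vector_field_def smooth_function_def cinv_cmap linear_scale[OF comp_in_linear]\<close>)
qed

lemma smooth_vector_field_zero:
  assumes "open U"
  shows "smooth_vector_field A U (\<lambda>x. 0)"
  unfolding smooth_vector_field_def
proof
  fix c assume c: "c \<in> A"
  show "smooth_on (cmap c ` (U \<inter> cdom c)) (in_chart A c (\<lambda>x. 0))"
    by (rule smooth_on_cong[OF open_chart_image[OF c assms(1)] smooth_on_const[where c = 0]])
      (use c in \<open>auto simp: cinv_cmap linear_0[OF comp_in_linear]\<close>)
qed

lemma smooth_vector_field_sum:
  assumes "open U" "\<And>i. i \<in> I \<Longrightarrow> smooth_vector_field A U (X i)"
  shows "smooth_vector_field A U (\<lambda>x. \<Sum>i\<in>I. X i x)"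
  using assms(2)
  by (induction I rule: infinite_finite_induct)
    (auto intro: smooth_vector_field_zero smooth_vector_field_add assms(1))

text \<open>In another chart \<open>d\<close> the components are a directional derivative of the
  transition map from \<open>c\<close> to \<open>d\<close>, precomposed with the inverse
  transition.\<close>

lemma smooth_coord_field:
  assumes c: "c \<in> A"
  shows "smooth_vector_field A (cdom c) (coord_field A c a)"
  unfolding smooth_vector_field_def
proof
  fix d assume d: "d \<in> A"
  let ?S = "cmap d ` (cdom c \<inter> cdom d)"
  have S: "open ?S" by (rule open_chart_image[OF d open_cdom[OF c]])
  have T: "open (cmap c ` (cdom c \<inter> cdom d))" by (rule open_chart_image'[OF c open_cdom[OF d]])
  have tr: "smooth_on ?S (cmap c \<circ> cinv d)"
    using compatible[OF d c] by (simp add: Int_commute)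
  have "smooth_on ?S ((\<lambda>u. frechet_derivative (cmap d \<circ> cinv c) (at u) a) \<circ> (cmap c \<circ> cinv d))"
    by (rule smooth_on_compose[OF S _ tr smooth_on_derivative[OF compatible[OF c d]]])
      (auto simp: cinv_cmap[OF d])
  then show "smooth_on ?S (in_chart A d (coord_field A c a))"
    by (rule smooth_on_cong[OF S]) (auto simp: cinv_cmap c d comp_in_vec_of_change)
qed

lemma in_chart_differentiable:
  "smooth_vector_field A U X \<Longrightarrow> c \<in> A \<Longrightarrow> p \<in> U \<Longrightarrow> p \<in> cdom c \<Longrightarrow>
    in_chart A c X differentiable (at (cmap c p))"
  unfolding smooth_vector_field_def
  by (blast intro: smooth_on_differentiable[where S = "cmap c ` (U \<inter> cdom c)"])

section \<open>The Lie bracket in an arbitrary chart\<close>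

text \<open>The definition uses the chart chosen at \<open>p\<close>, which may jump with
  \<open>p\<close>. The component fields in two charts are related by the transition map, so
  \<open>related_fields_bracket\<close> gives the same formula in one fixed chart, as smoothness
  requires.\<close>

lemma lie_bracket_in_chart:
  assumes U: "open U" "p \<in> U" and X: "smooth_vector_field A U X" and Y: "smooth_vector_field A U Y"
    and c: "c \<in> A" "p \<in> cdom c"
  shows "comp_in A c p (lie_bracket A X Y p) =
    frechet_derivative (in_chart A c Y) (at (cmap c p)) (comp_in A c p (X p)) -
    frechet_derivative (in_chart A c X) (at (cmap c p)) (comp_in A c p (Y p))"
proof -
  let ?k = "chart_at A p"
  note k = chart_at[of p]
  let ?S = "cmap ?k ` (cdom ?k \<inter> (U \<inter> cdom c))"
  let ?\<phi> = "cmap c \<circ> cinv ?k"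
  have \<phi>p: "?\<phi> (cmap ?k p) = cmap c p"
    by (simp add: cinv_cmap k)
  have S: "open ?S" by (intro open_chart_image' k open_Int U open_cdom c)
  have rel: "in_chart A c Z (?\<phi> u) = frechet_derivative ?\<phi> (at u) (in_chart A ?k Z u)"
    if "u \<in> ?S" for Z u
    using that k c by (auto simp: cinv_cmap comp_in_change[of ?k _ c])
  have "frechet_derivative (in_chart A c Y) (at (?\<phi> (cmap ?k p))) (in_chart A c X (?\<phi> (cmap ?k p))) -
      frechet_derivative (in_chart A c X) (at (?\<phi> (cmap ?k p))) (in_chart A c Y (?\<phi> (cmap ?k p))) =
    frechet_derivative ?\<phi> (at (cmap ?k p))
      (frechet_derivative (in_chart A ?k Y) (at (cmap ?k p)) (in_chart A ?k X (cmap ?k p)) -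
       frechet_derivative (in_chart A ?k X) (at (cmap ?k p)) (in_chart A ?k Y (cmap ?k p)))"
  proof (rule related_fields_bracket[OF S])
    show "smooth_on ?S ?\<phi>"
      by (rule smooth_on_subset[OF compatible]) (use k c in auto)
    show "cmap ?k p \<in> ?S" using k c U by auto
    show "in_chart A ?k X differentiable at (cmap ?k p)" "in_chart A ?k Y differentiable at (cmap ?k p)"
      using in_chart_differentiable X Y U k by blast+
    show "in_chart A c X differentiable at (?\<phi> (cmap ?k p))"
      "in_chart A c Y differentiable at (?\<phi> (cmap ?k p))"
      unfolding \<phi>p using in_chart_differentiable X Y U c by blast+
  qed (rule rel, assumption)+
  then show ?thesis
    by (simp add: \<phi>p cinv_cmap k c comp_in_chart_at lie_bracket_def Let_def)
      (simp add: comp_in_def)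
qed

lemma smooth_lie_bracket:
  assumes U: "open U" and X: "smooth_vector_field A U X" and Y: "smooth_vector_field A U Y"
  shows "smooth_vector_field A U (lie_bracket A X Y)"
  unfolding smooth_vector_field_def
proof
  fix c assume c: "c \<in> A"
  let ?S = "cmap c ` (U \<inter> cdom c)"
  have S: "open ?S" by (rule open_chart_image[OF c U])
  have X': "smooth_on ?S (in_chart A c X)" and Y': "smooth_on ?S (in_chart A c Y)"
    using X Y c by (auto simp: smooth_vector_field_def)
  have "smooth_on ?S (\<lambda>z. frechet_derivative (in_chart A c Y) (at z) (in_chart A c X z) +
      (-1) *\<^sub>R frechet_derivative (in_chart A c X) (at z) (in_chart A c Y z))"
    by (intro smooth_on_add smooth_on_scaleR smooth_on_const smooth_on_derivative_field S X' Y')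
  then show "smooth_on ?S (in_chart A c (lie_bracket A X Y))"
    by (rule smooth_on_cong[OF S]) (auto simp: cinv_cmap c lie_bracket_in_chart[OF U _ X Y])
qed

text \<open>Coordinate fields have constant components in their own chart, so both derivatives
  vanish.\<close>

lemma lie_bracket_coord_fields:
  "lie_bracket A (coord_field A (chart_at A p) a) (coord_field A (chart_at A p) b) p = 0"
proof -
  let ?c = "chart_at A p"
  have "frechet_derivative (in_chart A ?c (coord_field A ?c a)) (at (cmap ?c p)) =
      frechet_derivative (\<lambda>z. a) (at (cmap ?c p))" for a
    by (rule frechet_derivative_cong_open[of "cmap ?c ` cdom ?c"])
      (use charts[OF chart_at(1)] chart_at in \<open>auto simp: cinv_cmap comp_in_vec_of\<close>)
  then show ?thesis by (simp add: lie_bracket_def)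
qed

end

section \<open>Connections\<close>

context affine_connection
begin

text \<open>The Leibniz rule for the zero function times the zero field: both terms on the right are
  zero.\<close>

lemma nabla_zero: "nabla p v (\<lambda>x. 0) = 0"
proof -
  have "nabla p v (\<lambda>x. 0 *\<^sub>R (0::'e)) = dir_deriv A p v (\<lambda>x. 0) *\<^sub>R 0 + 0 *\<^sub>R nabla p v (\<lambda>x. 0)"
    by (rule nabla_leibniz[of UNIV])
      (auto simp: smooth_vector_field_zero smooth_function_def o_def smooth_on_const)
  then show ?thesis by simp
qed

lemma nabla_sum:
  assumes "open U" "p \<in> U" "\<And>i. i \<in> I \<Longrightarrow> smooth_vector_field A U (Y i)"
  shows "nabla p v (\<lambda>x. \<Sum>i\<in>I. Y i x) = (\<Sum>i\<in>I. nabla p v (Y i))"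
  using assms(3)
proof (induction I rule: infinite_finite_induct)
  case (insert i I)
  have "nabla p v (\<lambda>x. Y i x + (\<Sum>i\<in>I. Y i x)) = nabla p v (Y i) + nabla p v (\<lambda>x. \<Sum>i\<in>I. Y i x)"
    using insert by (intro nabla_add[OF assms(1,2)] smooth_vector_field_sum assms(1)) auto
  then show ?case using insert by simp
qed (simp_all add: nabla_zero)

text \<open>No bump function is needed: the difference of the two fields is its product with the
  indicator function of the complement of \<open>U\<close>, which is smooth on \<open>U\<close>.\<close>

lemma nabla_local:
  assumes U: "open U" "p \<in> U" and Y: "smooth_vector_field A U Y" and Z: "smooth_vector_field A U Z"
    and eq: "\<And>x. x \<in> U \<Longrightarrow> Y x = Z x"
  shows "nabla p v Y = nabla p v Z"
proof -
  define f :: "'p \<Rightarrow> real" where "f x = (if x \<in> U then 0 else 1)" for x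
  define W where "W x = Y x - Z x" for x
  have W: "smooth_vector_field A U W"
    by (rule smooth_vector_field_cong[OF U(1) smooth_vector_field_zero[OF U(1)]])
      (simp add: W_def eq)
  have f: "smooth_function A U f"
    unfolding smooth_function_def
  proof
    fix c assume c: "c \<in> A"
    show "smooth_on (cmap c ` (U \<inter> cdom c)) (f \<circ> cinv c)"
      by (rule smooth_on_cong[OF open_chart_image[OF c U(1)] smooth_on_const[where c = 0]])
        (use c in \<open>auto simp: f_def cinv_cmap\<close>)
  qed
  have "(\<lambda>x. f x *\<^sub>R W x) = W"
    by (auto simp: f_def W_def eq)
  then have "nabla p v W = dir_deriv A p v f *\<^sub>R W p + f p *\<^sub>R nabla p v W"
    using nabla_leibniz[OF U f W, of v] by simp
  \<comment> \<open>Since \<open>W p\<close> and \<open>f p\<close> are both 0, both Leibniz terms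
    vanish, whatever the value of \<open>dir_deriv A p v f\<close>.\<close>
  then have "nabla p v W = 0"
    using U(2) eq by (simp add: f_def W_def)
  moreover have "nabla p v (\<lambda>x. Z x + W x) = nabla p v Z + nabla p v W"
    by (rule nabla_add[OF U Z W])
  ultimately show ?thesis by (simp add: W_def)
qed

end

text \<open>Torsion freeness for two coordinate fields: their bracket vanishes, and at
  \<open>p\<close> they take the values \<open>a\<close> and \<open>b\<close>.\<close>

lemma (in levi_civita_connection) christoffel_symmetric:
  "nabla p a (coord_field A (chart_at A p) b) = nabla p b (coord_field A (chart_at A p) a)"
  using torsion_free[OF open_cdom[OF chart_at(1)] chart_at(2)
      smooth_coord_field[OF chart_at(1)] smooth_coord_field[OF chart_at(1)], of p a b]
  by (simp add: vec_of_chart_at lie_bracket_coord_fields)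

text \<open>The parallelism of \<open>J\<close> in coordinates: \<open>J\<close> of a coordinate
  field is expanded in the coordinate frame and differentiated by the Leibniz rule. This pointwise
  form can be used along an immersion, where sections need not extend to ambient fields.\<close>

lemma (in indefinite_kaehler_manifold) J_nabla_coord_field:
  fixes p defines "c \<equiv> chart_at A p"
  shows "J p (nabla p v (coord_field A c b)) =
    frechet_derivative (in_chart A c (\<lambda>x. J x (vec_of A c x b))) (at (cmap c p)) v +
    (\<Sum>a\<in>Basis. (J p b \<bullet> a) *\<^sub>R nabla p v (coord_field A c a))"
proof -
  let ?U = "cdom c"
  define f where "f a x = comp_in A c x (J x (vec_of A c x b)) \<bullet> a" for a x
  have c: "c \<in> A" and p: "p \<in> ?U"
    by (simp_all add: c_def chart_at)
  have U: "open ?U" by (rule open_cdom[OF c])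
  have Jc: "smooth_on (cmap c ` ?U) (in_chart A c (\<lambda>x. J x (vec_of A c x b)))"
    by (rule J_smooth[OF c])
  have f: "smooth_function A ?U (f a)" for a
    unfolding smooth_function_def
  proof
    fix d assume d: "d \<in> A"
    let ?S = "cmap d ` (?U \<inter> cdom d)"
    have S: "open ?S" by (rule open_chart_image[OF d U])
    have im: "open (cmap c ` ?U)" using charts[OF c] by blast
    have tr: "smooth_on ?S (cmap c \<circ> cinv d)"
      using compatible[OF d c] by (simp add: Int_commute)
    have "smooth_on ?S
        ((\<lambda>z. in_chart A c (\<lambda>x. J x (vec_of A c x b)) z \<bullet> a) \<circ> (cmap c \<circ> cinv d))"
      by (rule smooth_on_compose[OF S _ tr smooth_on_inner[OF im Jc]]) (auto simp: cinv_cmap[OF d])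
    then show "smooth_on ?S (f a \<circ> cinv d)"
      by (rule smooth_on_cong[OF S]) (auto simp: f_def cinv_cmap c d)
  qed
  have coord: "smooth_vector_field A ?U (coord_field A c a)" for a
    by (rule smooth_coord_field[OF c])
  note fcoord = smooth_vector_field_scaleR[OF U f coord]
  have expand: "(\<Sum>a\<in>Basis. f a x *\<^sub>R vec_of A c x a) = J x (vec_of A c x b)" if "x \<in> ?U" for x
    using linear_eq_sum_Basis[OF vec_of_linear[OF c that], of "comp_in A c x (J x (vec_of A c x b))"]
    by (simp add: f_def vec_of_comp_in[OF c that])
  have deriv: "dir_deriv A p v (f a) =
      frechet_derivative (in_chart A c (\<lambda>x. J x (vec_of A c x b))) (at (cmap c p)) v \<bullet> a" for a
    using frechet_derivative_inner[OF smooth_on_differentiable[OF Jc], of "cmap c p" a v] p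
    by (simp add: dir_deriv_def f_def o_def c_def)
  have fp: "f a p = J p b \<bullet> a" for a
    by (simp add: f_def c_def comp_in_chart_at vec_of_chart_at)
  have sum: "smooth_vector_field A ?U (\<lambda>x. \<Sum>a\<in>Basis. f a x *\<^sub>R vec_of A c x a)"
    by (rule smooth_vector_field_sum[OF U fcoord])
  have "J p (nabla p v (coord_field A c b)) = nabla p v (\<lambda>x. J x (vec_of A c x b))"
    by (rule J_parallel[OF U p coord, symmetric])
  \<comment> \<open>The expansion holds only on the chart domain, so equality of the two covariant
    derivatives rests on the locality of the connection.\<close>
  also have "\<dots> = nabla p v (\<lambda>x. \<Sum>a\<in>Basis. f a x *\<^sub>R vec_of A c x a)"
  proof (rule nabla_local[OF U p _ sum])
    show "smooth_vector_field A ?U (\<lambda>x. J x (vec_of A c x b))"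
      by (rule smooth_vector_field_cong[OF U sum expand])
  qed (simp add: expand)
  also have "\<dots> = (\<Sum>a\<in>Basis. nabla p v (\<lambda>x. f a x *\<^sub>R vec_of A c x a))"
    by (rule nabla_sum[OF U p fcoord])
  also have "\<dots> = (\<Sum>a\<in>Basis. dir_deriv A p v (f a) *\<^sub>R a + f a p *\<^sub>R nabla p v (coord_field A c a))"
    using nabla_leibniz[OF U p f coord, of v] by (simp add: vec_of_chart_at c_def)
  finally show ?thesis
    by (simp add: sum.distrib deriv fp euclidean_representation)
qed

section \<open>The induced covariant derivative along an immersion\<close>

abbreviation along_chart ::
  "('p, 'e::euclidean_space) chart set \<Rightarrow> ('m \<Rightarrow> 'p) \<Rightarrow> ('p, 'e) chart \<Rightarrow> ('m, 'f) chart \<Rightarrow>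
    ('m \<Rightarrow> 'e) \<Rightarrow> 'f \<Rightarrow> 'e" where
  "along_chart A \<iota> c k Z \<equiv> \<lambda>u. comp_in A c (\<iota> (cinv k u)) (Z (cinv k u))"

context immersed_submanifold
begin

section \<open>The differential of the immersion in arbitrary charts\<close>

lemma open_vimage_\<iota>: "open V \<Longrightarrow> open (\<iota> -` V)"
  using \<iota>_continuous by (simp add: open_vimage)

lemma open_adapted_image: "c \<in> A \<Longrightarrow> k \<in> B \<Longrightarrow> open (cmap k ` (cdom k \<inter> \<iota> -` cdom c))"
  by (intro open_chart_image' open_vimage_\<iota> ambient.open_cdom)

lemma \<iota>_differentiable:
  "c \<in> A \<Longrightarrow> k \<in> B \<Longrightarrow> p \<in> cdom k \<Longrightarrow> \<iota> p \<in> cdom c \<Longrightarrow>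
    (cmap c \<circ> \<iota> \<circ> cinv k) differentiable (at (cmap k p))"
  by (rule smooth_on_differentiable[OF \<iota>_smooth]) auto

lemma push_linear: "linear (push A B \<iota> p)"
  unfolding push_def[abs_def]
  by (intro linear_frechet_derivative \<iota>_differentiable chart_at ambient.chart_at)

text \<open>\<open>push\<close> is defined by the charts chosen at \<open>p\<close> and
  \<open>\<iota> p\<close>. The ambient chart is replaced by composing with a transition map, the
  chart of the submanifold by \<open>change_of_chart\<close>.\<close>

lemma push_in_chart:
  assumes c: "c \<in> A" "\<iota> p \<in> cdom c" and k: "k \<in> B" "p \<in> cdom k"
  shows "comp_in A c (\<iota> p) (push A B \<iota> p v) =
    frechet_derivative (cmap c \<circ> \<iota> \<circ> cinv k) (at (cmap k p)) (comp_in B k p v)"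
proof -
  let ?c = "chart_at A (\<iota> p)" and ?k = "chart_at B p"
  note c0 = ambient.chart_at[of "\<iota> p"] and k0 = chart_at[of p]
  let ?\<phi> = "cmap ?c \<circ> \<iota> \<circ> cinv ?k" and ?S = "cmap ?k ` (cdom ?k \<inter> \<iota> -` (cdom ?c \<inter> cdom c))"
  have \<phi>p: "?\<phi> (cmap ?k p) = cmap ?c (\<iota> p)"
    by (simp add: cinv_cmap k0)
  have tr: "(cmap c \<circ> cinv ?c) differentiable (at (?\<phi> (cmap ?k p)))"
    unfolding \<phi>p by (intro ambient.transition_differentiable c c0)
  have "comp_in A c (\<iota> p) (push A B \<iota> p v)
      = frechet_derivative ((cmap c \<circ> cinv ?c) \<circ> ?\<phi>) (at (cmap ?k p)) v"
    unfolding comp_in_def push_def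
    using frechet_derivative_compose_at(2)[OF \<iota>_differentiable[OF c0(1) k0 c0(2)] tr, of v]
    unfolding \<phi>p by metis
  also have "frechet_derivative ((cmap c \<circ> cinv ?c) \<circ> ?\<phi>) (at (cmap ?k p))
      = frechet_derivative (cmap c \<circ> \<iota> \<circ> cinv ?k) (at (cmap ?k p))"
  proof (rule frechet_derivative_cong_open[of ?S])
    show "open ?S"
      by (intro open_chart_image' k0 open_vimage_\<iota> open_Int ambient.open_cdom c c0)
    show "cmap ?k p \<in> ?S" using c c0 k0 by auto
  qed (use c0 k0 in \<open>auto simp: cinv_cmap ambient.cinv_cmap\<close>)
  also have "frechet_derivative (cmap c \<circ> \<iota> \<circ> cinv ?k) (at (cmap ?k p)) v
      = frechet_derivative (cmap c \<circ> \<iota> \<circ> cinv k) (at (cmap k p)) (comp_in B k p v)"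
    unfolding comp_in_def by (rule change_of_chart(2)[OF k0 k \<iota>_differentiable[OF c(1) k c(2)]])
  finally show ?thesis .
qed

lemma smooth_along_push:
  assumes "smooth_vector_field B UNIV X"
  shows "smooth_along A B \<iota> UNIV (\<lambda>p. push A B \<iota> p (X p))"
  unfolding smooth_along_def
proof (intro ballI)
  fix c k assume c: "c \<in> A" and k: "k \<in> B"
  let ?S = "cmap k ` (cdom k \<inter> \<iota> -` cdom c)"
  have S: "open ?S" by (rule open_adapted_image[OF c k])
  have "smooth_on ?S (in_chart B k X)"
    by (rule smooth_on_subset[of "cmap k ` (UNIV \<inter> cdom k)"])
      (use assms k in \<open>auto simp: smooth_vector_field_def\<close>)
  then have "smooth_on ?S
      (\<lambda>u. frechet_derivative (cmap c \<circ> \<iota> \<circ> cinv k) (at u) (in_chart B k X u))"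
    by (rule smooth_on_derivative_field[OF S \<iota>_smooth[OF c k]])
  then have "smooth_on ?S (along_chart A \<iota> c k (\<lambda>p. push A B \<iota> p (X p)))"
    by (rule smooth_on_cong[OF S]) (auto simp: cinv_cmap c k push_in_chart[of c _ k])
  then show "smooth_on (cmap k ` (UNIV \<inter> cdom k \<inter> \<iota> -` cdom c))
      (along_chart A \<iota> c k (\<lambda>p. push A B \<iota> p (X p)))"
    by simp
qed

lemma smooth_along_zero: "smooth_along A B \<iota> UNIV (\<lambda>p. 0)"
  unfolding smooth_along_def
proof (intro ballI)
  fix c k assume c: "c \<in> A" and k: "k \<in> B"
  let ?S = "cmap k ` (cdom k \<inter> \<iota> -` cdom c)"
  have "smooth_on ?S (along_chart A \<iota> c k (\<lambda>p. 0))"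
    by (rule smooth_on_cong[OF open_adapted_image[OF c k] smooth_on_const[where c = 0]])
      (auto simp: cinv_cmap k linear_0[OF ambient.comp_in_linear[OF c]])
  then show "smooth_on (cmap k ` (UNIV \<inter> cdom k \<inter> \<iota> -` cdom c)) (along_chart A \<iota> c k (\<lambda>p. 0))"
    by simp
qed

text \<open>In the chosen charts a vector at the base point equals its components, so the derivative
  splits into the derivative of the components and a Christoffel term.\<close>

lemma induced_deriv_at:
  "induced_deriv A B \<iota> nabla X Z p =
    frechet_derivative (along_chart A \<iota> (chart_at A (\<iota> p)) (chart_at B p) Z)
      (at (cmap (chart_at B p) p)) (X p) +
    (\<Sum>b\<in>Basis. (Z p \<bullet> b) *\<^sub>R
      nabla (\<iota> p) (push A B \<iota> p (X p)) (coord_field A (chart_at A (\<iota> p)) b))"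
  by (simp add: induced_deriv_def Let_def sum.distrib ambient.vec_of_chart_at
      ambient.comp_in_chart_at cinv_cmap chart_at euclidean_representation)

end

section \<open>Torsion freeness and parallelism of \<open>J\<close> along an immersion\<close>

locale kaehler_immersion = K: indefinite_kaehler_manifold A g q nabla J + immersed_submanifold A B \<iota>
  for A :: "('p::{t2_space, second_countable_topology}, 'e::euclidean_space) chart set"
    and g q nabla J
    and B :: "('m::{t2_space, second_countable_topology}, 'f::euclidean_space) chart set"
    and \<iota>
begin

lemma nabla_coord_linear: "linear (\<lambda>v. nabla p v (coord_field A (chart_at A p) b))"
  by (rule K.nabla_linear[OF K.open_cdom[OF K.chart_at(1)] K.chart_at(2)
        K.smooth_coord_field[OF K.chart_at(1)]])

text \<open>Expanding the direction over \<open>Basis\<close> as well gives a double sum, in which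
  the symmetry of the Christoffel symbols permits exchanging \<open>v\<close> and
  \<open>w\<close>.\<close>

lemma christoffel_sum_symmetric:
  fixes p v w defines "c \<equiv> chart_at A p"
  shows "(\<Sum>b\<in>Basis. (w \<bullet> b) *\<^sub>R nabla p v (coord_field A c b)) =
    (\<Sum>b\<in>Basis. (v \<bullet> b) *\<^sub>R nabla p w (coord_field A c b))"
proof -
  have "(\<Sum>b\<in>Basis. (w \<bullet> b) *\<^sub>R nabla p v (coord_field A c b)) =
    (\<Sum>b\<in>Basis. \<Sum>a\<in>Basis. ((w \<bullet> b) * (v \<bullet> a)) *\<^sub>R nabla p a (coord_field A c b))" for v w
    by (subst linear_eq_sum_Basis[OF nabla_coord_linear, of p, folded c_def])
      (simp add: scaleR_sum_right)
  note expand = this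
  show ?thesis
    unfolding expand[of w v] expand[of v w]
    by (subst sum.swap) (simp add: K.christoffel_symmetric[of p, folded c_def] mult.commute)
qed

text \<open>The Christoffel terms cancel by symmetry. The derivative terms are those of
  \<open>derivative_field_antisym\<close> for \<iota> in charts, whose right-hand side is the pushed
  bracket.\<close>

lemma induced_deriv_torsion_free:
  assumes X: "smooth_vector_field B UNIV X" and Y: "smooth_vector_field B UNIV Y"
  shows "induced_deriv A B \<iota> nabla X (\<lambda>p. push A B \<iota> p (Y p)) p -
      induced_deriv A B \<iota> nabla Y (\<lambda>p. push A B \<iota> p (X p)) p =
    push A B \<iota> p (lie_bracket B X Y p)"
proof -
  let ?c = "chart_at A (\<iota> p)" and ?k = "chart_at B p"
  note c = K.chart_at[of "\<iota> p"] and k = chart_at[of p]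
  let ?\<phi> = "cmap ?c \<circ> \<iota> \<circ> cinv ?k" and ?S = "cmap ?k ` (cdom ?k \<inter> \<iota> -` cdom ?c)"
  have S: "open ?S" "smooth_on ?S ?\<phi>" "cmap ?k p \<in> ?S"
    using open_adapted_image[OF c(1) k(1)] \<iota>_smooth[OF c(1) k(1)] c k by auto
  have push: "frechet_derivative (along_chart A \<iota> ?c ?k (\<lambda>p. push A B \<iota> p (Z p))) (at (cmap ?k p)) =
      frechet_derivative (\<lambda>u. frechet_derivative ?\<phi> (at u) (in_chart B ?k Z u)) (at (cmap ?k p))" for Z
    by (rule frechet_derivative_cong_open[OF S(1,3)])
      (use c k in \<open>auto simp: cinv_cmap push_in_chart[of ?c _ ?k]\<close>)
  have diff: "in_chart B ?k X differentiable (at (cmap ?k p))"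
    "in_chart B ?k Y differentiable (at (cmap ?k p))"
    using in_chart_differentiable X Y k by blast+
  have self: "in_chart B ?k Z (cmap ?k p) = Z p" for Z
    by (simp add: cinv_cmap k comp_in_chart_at)
  show ?thesis
    using derivative_field_antisym[OF S diff]
      christoffel_sum_symmetric[of "push A B \<iota> p (Y p)" "\<iota> p" "push A B \<iota> p (X p)"]
    unfolding self induced_deriv_at push lie_bracket_def Let_def
    by (simp add: push_def[symmetric])
qed

text \<open>Along \<iota> the components of \<open>J Z\<close> are sums of components of
  \<open>Z\<close> times components of \<open>J\<close> on coordinate fields. The product rule
  yields derivatives of \<open>J\<close>, which \<open>J_nabla_coord_field\<close> trades for
  Christoffel terms.\<close>

lemma induced_deriv_J:
  assumes Z: "smooth_along A B \<iota> UNIV Z"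
  shows "induced_deriv A B \<iota> nabla X (\<lambda>x. J (\<iota> x) (Z x)) p =
    J (\<iota> p) (induced_deriv A B \<iota> nabla X Z p)"
proof -
  let ?c = "chart_at A (\<iota> p)" and ?k = "chart_at B p"
  note c = K.chart_at[of "\<iota> p"] and k = chart_at[of p]
  let ?\<phi> = "cmap ?c \<circ> \<iota> \<circ> cinv ?k" and ?S = "cmap ?k ` (cdom ?k \<inter> \<iota> -` cdom ?c)"
  let ?u = "cmap ?k p" and ?v = "push A B \<iota> p (X p)"
  define z where "z = along_chart A \<iota> ?c ?k Z"
  define j where "j b = in_chart A ?c (\<lambda>x. J x (vec_of A ?c x b))" for b
  have S: "open ?S" "?u \<in> ?S"
    using open_adapted_image[OF c(1) k(1)] c k by auto
  have \<phi>u: "?\<phi> ?u = cmap ?c (\<iota> p)"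
    by (simp add: cinv_cmap k)
  have "smooth_on (cmap ?k ` (UNIV \<inter> cdom ?k \<inter> \<iota> -` cdom ?c)) z"
    unfolding z_def using Z c(1) k(1) unfolding smooth_along_def by blast
  then have "smooth_on ?S z" by simp
  then have dz: "(z has_derivative frechet_derivative z (at ?u)) (at ?u)"
    using smooth_on_differentiable[OF _ S(2)] frechet_derivative_works by blast
  have dj: "j b differentiable (at (?\<phi> ?u))" for b
    unfolding \<phi>u j_def by (rule smooth_on_differentiable[OF K.J_smooth[OF c(1)]]) (use c in simp)
  have "((j b \<circ> ?\<phi>) has_derivative
      frechet_derivative (j b) (at (?\<phi> ?u)) \<circ> frechet_derivative ?\<phi> (at ?u)) (at ?u)" for b
    by (intro diff_chain_at)
      (use dj \<iota>_differentiable[OF c(1) k c(2)] in \<open>simp_all add: frechet_derivative_works[symmetric]\<close>)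
  then have dj\<phi>: "((\<lambda>u. j b (?\<phi> u)) has_derivative
      (\<lambda>w. frechet_derivative (j b) (at (cmap ?c (\<iota> p))) (push A B \<iota> p w))) (at ?u)" for b
    by (simp add: o_def push_def[abs_def] cinv_cmap k)
  have zu: "z ?u = Z p"
    by (simp add: z_def cinv_cmap k K.comp_in_chart_at)
  have ju: "j b (?\<phi> ?u) = J (\<iota> p) b" for b
    unfolding \<phi>u by (simp add: j_def K.cinv_cmap c K.comp_in_chart_at K.vec_of_chart_at)
  have expand: "along_chart A \<iota> ?c ?k (\<lambda>x. J (\<iota> x) (Z x)) u = (\<Sum>b\<in>Basis. (z u \<bullet> b) *\<^sub>R j b (?\<phi> u))"
    if "u \<in> ?S" for u
  proof -
    obtain x where x: "x \<in> cdom ?k" "\<iota> x \<in> cdom ?c" "u = cmap ?k x"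
      using \<open>u \<in> ?S\<close> by auto
    have lin: "linear (\<lambda>a. comp_in A ?c (\<iota> x) (J (\<iota> x) (vec_of A ?c (\<iota> x) a)))"
      using linear_compose[OF K.vec_of_linear[OF c(1) x(2)]
          linear_compose[OF K.J_linear K.comp_in_linear[OF c(1) x(2)]]]
      by (simp add: o_def)
    have "comp_in A ?c (\<iota> x) (J (\<iota> x) (vec_of A ?c (\<iota> x) (comp_in A ?c (\<iota> x) (Z x)))) =
        (\<Sum>b\<in>Basis. (comp_in A ?c (\<iota> x) (Z x) \<bullet> b) *\<^sub>R
          comp_in A ?c (\<iota> x) (J (\<iota> x) (vec_of A ?c (\<iota> x) b)))"
      by (rule linear_eq_sum_Basis[OF lin])
    then show ?thesis
      by (simp add: x z_def j_def cinv_cmap k K.cinv_cmap c K.vec_of_comp_in[OF c(1) x(2)])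
  qed
  have "((\<lambda>u. \<Sum>b\<in>Basis. (z u \<bullet> b) *\<^sub>R j b (?\<phi> u)) has_derivative
      (\<lambda>w. \<Sum>b\<in>Basis. (z ?u \<bullet> b) *\<^sub>R frechet_derivative (j b) (at (cmap ?c (\<iota> p))) (push A B \<iota> p w)
        + (frechet_derivative z (at ?u) w \<bullet> b) *\<^sub>R j b (?\<phi> ?u))) (at ?u)"
    by (intro has_derivative_sum has_derivative_scaleR has_derivative_inner_left dz dj\<phi>)
  from frechet_derivative_eqI[OF has_derivative_transform_within_open[OF this S expand[symmetric]]]
  have D: "frechet_derivative (along_chart A \<iota> ?c ?k (\<lambda>x. J (\<iota> x) (Z x))) (at ?u) w =
      (\<Sum>b\<in>Basis. (Z p \<bullet> b) *\<^sub>R frechet_derivative (j b) (at (cmap ?c (\<iota> p))) (push A B \<iota> p w))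
        + J (\<iota> p) (frechet_derivative z (at ?u) w)" for w
    unfolding zu ju sum.distrib linear_eq_sum_Basis[OF K.J_linear, symmetric] by simp
  \<comment> \<open>The Christoffel term of \<open>J Z\<close> is regrouped by the components of
    \<open>Z\<close>, to match the sum in \<open>J_nabla_coord_field\<close>.\<close>
  have "(\<Sum>a\<in>Basis. (J (\<iota> p) (Z p) \<bullet> a) *\<^sub>R nabla (\<iota> p) ?v (coord_field A ?c a)) =
      (\<Sum>a\<in>Basis. \<Sum>b\<in>Basis. ((Z p \<bullet> b) * (J (\<iota> p) b \<bullet> a)) *\<^sub>R nabla (\<iota> p) ?v (coord_field A ?c a))"
    by (subst linear_eq_sum_Basis[OF K.J_linear, of "\<iota> p" "Z p"])
      (simp add: inner_sum_left scaleR_sum_left)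
  also have "\<dots> = (\<Sum>b\<in>Basis. (Z p \<bullet> b) *\<^sub>R
      (\<Sum>a\<in>Basis. (J (\<iota> p) b \<bullet> a) *\<^sub>R nabla (\<iota> p) ?v (coord_field A ?c a)))"
    by (subst sum.swap) (simp add: scaleR_sum_right)
  finally have J\<Gamma>: "(\<Sum>a\<in>Basis. (J (\<iota> p) (Z p) \<bullet> a) *\<^sub>R nabla (\<iota> p) ?v (coord_field A ?c a)) = \<dots>" .
  have "J (\<iota> p) (\<Sum>b\<in>Basis. (Z p \<bullet> b) *\<^sub>R nabla (\<iota> p) ?v (coord_field A ?c b)) =
      (\<Sum>b\<in>Basis. (Z p \<bullet> b) *\<^sub>R (frechet_derivative (j b) (at (cmap ?c (\<iota> p))) ?v +
        (\<Sum>a\<in>Basis. (J (\<iota> p) b \<bullet> a) *\<^sub>R nabla (\<iota> p) ?v (coord_field A ?c a))))"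
    by (simp only: linear_sum[OF K.J_linear] linear_scale[OF K.J_linear] K.J_nabla_coord_field j_def)
  then show ?thesis
    unfolding induced_deriv_at D J\<Gamma> linear_add[OF K.J_linear] z_def[symmetric]
    by (simp add: scaleR_add_right sum.distrib)
qed

end

section \<open>Decompositions of the ambient tangent space\<close>

text \<open>Orthogonal projection onto a non-degenerate subspace of an indefinite form: a dimension
  count replaces positivity.\<close>

lemma nondegenerate_complement:
  fixes b :: "'e::euclidean_space \<Rightarrow> 'e \<Rightarrow> real"
  assumes b: "bilinear b" and V: "subspace V" "nondegenerate_on b V"
  shows "\<exists>v\<in>V. e - v \<in> perp b V"
proof -
  obtain B where B: "B \<subseteq> V" "independent B" "V \<subseteq> span B" "card B = dim V"
    using basis_exists by blast
  have fin: "finite B" using B(2) by (rule independent_imp_finite)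
  have span: "span B = V" using B V(1) by (metis span_minimal subset_antisym)
  \<comment> \<open>\<open>F\<close> records the products with a basis of \<open>V\<close>, so its
    kernel is \<open>perp b V\<close>. By non-degeneracy it is injective on \<open>V\<close>, hence
    maps \<open>V\<close> onto \<open>V\<close>, and some \<open>v\<close> in \<open>V\<close> has
    the same image as \<open>e\<close>.\<close>
  define F where "F e = (\<Sum>i\<in>B. b e i *\<^sub>R i)" for e
  have lin: "linear (\<lambda>e. b e i)" "linear (b e)" for i e
    using b by (auto simp: bilinear_def)
  have linF: "linear F"
    unfolding F_def
    by (rule linearI)
      (simp_all add: linear_add[OF lin(1)] linear_scale[OF lin(1)] scaleR_add_left sum.distrib scaleR_sum_right)
  have ker: "b x w = 0" if "F x = 0" "w \<in> V" for x w
  proof -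
    have "b x i = 0" if "i \<in> B" for i
      using independentD[OF B(2) fin order_refl, of "b x"] \<open>F x = 0\<close> that by (simp add: F_def)
    moreover have "w \<in> span B" using that span by simp
    ultimately show ?thesis
      using linear_eq_on[OF lin(2) linear_zero] by metis
  qed
  have "inj_on F V"
    unfolding linear_inj_on_iff_eq_0[OF linF V(1)]
    using ker V(2) by (auto simp: nondegenerate_on_def)
  then have "dim (F ` V) = dim V"
    using dim_image_eq[OF linF, of V] V(1) by (metis span_eq_iff)
  moreover have "F ` UNIV \<subseteq> V"
    unfolding F_def using B(1) V(1) by (auto intro!: subspace_sum subspace_scale)
  ultimately have "F ` V = V"
    by (intro subspace_dim_equal linear_subspace_image linF V(1)) auto
  then obtain v where v: "v \<in> V" "F e = F v"
    using \<open>F ` UNIV \<subseteq> V\<close> by (metis image_iff rangeI subsetD)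
  then have "F (e - v) = 0" by (simp add: linear_diff[OF linF])
  then show ?thesis using v(1) ker by (auto simp: perp_def)
qed

lemma direct_sum_sub:
  assumes "direct_sum E V W" "0 \<in> V" "0 \<in> W"
  shows "V \<subseteq> E" "W \<subseteq> E"
proof -
  have E: "E = {v + w |v w. v \<in> V \<and> w \<in> W}" using assms(1) by (simp add: direct_sum_def)
  show "V \<subseteq> E" unfolding E using assms(3) by force
  show "W \<subseteq> E" unfolding E using assms(2) by force
qed

lemma direct_sumE:
  assumes "direct_sum E V W" "x \<in> E"
  obtains v w where "v \<in> V" "w \<in> W" "x = v + w"
  using assms unfolding direct_sum_def by blast

lemma subspace_perp:
  assumes "bilinear b"
  shows "subspace (perp b V)"
proof -
  have lin: "linear (\<lambda>e. b e i)" for i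
    using assms by (auto simp: bilinear_def)
  show ?thesis
    by (auto simp: subspace_def perp_def linear_add[OF lin] linear_scale[OF lin] linear_0[OF lin])
qed

lemma subbundle_of_rank_subspace:
  assumes "subbundle_of_rank A B \<iota> k E"
  shows "subspace (E p)"
  using assms unfolding subbundle_of_rank_def local_frame_def by (metis subspace_span)

lemma subbundle_subspace: "subbundle A B \<iota> E \<Longrightarrow> subspace (E p)"
  unfolding subbundle_def using subbundle_of_rank_subspace by blast

section \<open>The components in \<open>TM\<close>, \<open>ltr(TM)\<close> and the screen
  transversal bundle\<close>

context lightlike_submanifold
begin

lemma metric_linear: "linear (g p v)" "linear (\<lambda>v. g p v w)"
  using metric_bilinear by (auto simp: bilinear_def)

lemma subspaces:
  "subspace (STM p)" "subspace (STMp p)" "subspace (ltr p)"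
  "subspace (tangent A B \<iota> p)" "subspace (normal A g B \<iota> p)" "subspace (radical A g B \<iota> p)"
proof -
  show "subspace (STM p)" "subspace (STMp p)" "subspace (ltr p)"
    using screen_bundle screen_transversal_bundle ltr_bundle subbundle_subspace
      subbundle_of_rank_subspace by blast+
  show "subspace (tangent A B \<iota> p)"
    unfolding tangent_def by (rule linear_subspace_image[OF push_linear subspace_UNIV])
  moreover show "subspace (normal A g B \<iota> p)"
    unfolding normal_def by (rule subspace_perp[OF metric_bilinear])
  ultimately show "subspace (radical A g B \<iota> p)"
    unfolding radical_def by (rule subspace_inter)
qed

lemma screen_subset: "STM p \<subseteq> tangent A B \<iota> p" "STMp p \<subseteq> normal A g B \<iota> p"
  using screen_sum[of p] screen_transversal_sum[of p] subspaces[THEN subspace_0]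
  by (auto simp: orthogonal_sum_def dest: direct_sum_sub)

lemma screens_orthogonal: "v \<in> STM p \<Longrightarrow> w \<in> STMp p \<Longrightarrow> g (\<iota> p) w v = 0"
  using screen_subset unfolding normal_def perp_def by blast

text \<open>The orthogonal sum of the two screens is non-degenerate, so \<open>e\<close> splits into
  a part in it and a part orthogonal to it. The latter is a radical vector plus an element of
  \<open>ltr p\<close>, and the radical vector joins the screen part to form the tangent
  component.\<close>

lemma transversal_decomp:
  obtains t l s where "t \<in> tangent A B \<iota> p" "l \<in> ltr p" "s \<in> STMp p" "e = t + l + s"
proof -
  let ?W = "{v + w |v w. v \<in> STM p \<and> w \<in> STMp p}"
  have W: "subspace ?W" by (rule subspace_sums[OF subspaces(1,2)])
  have "nondegenerate_on (g (\<iota> p)) ?W"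
    unfolding nondegenerate_on_def
  proof (intro ballI impI)
    fix x assume "x \<in> ?W" and x: "\<forall>w\<in>?W. g (\<iota> p) x w = 0"
    then obtain v w where vw: "v \<in> STM p" "w \<in> STMp p" "x = v + w" by blast
    have "g (\<iota> p) v v' = 0" if "v' \<in> STM p" for v'
    proof -
      have "v' \<in> ?W" using that subspace_0[OF subspaces(2)] by force
      then have "g (\<iota> p) (v + w) v' = 0" using x unfolding vw(3) by blast
      then show ?thesis
        using screens_orthogonal[OF that vw(2)] by (simp add: linear_add[OF metric_linear(2)])
    qed
    moreover have "g (\<iota> p) w w' = 0" if "w' \<in> STMp p" for w'
    proof -
      have "w' \<in> ?W" using that subspace_0[OF subspaces(1)] by force
      then have "g (\<iota> p) (v + w) w' = 0" using x unfolding vw(3) by blast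
      then show ?thesis
        using screens_orthogonal[OF vw(1) that]
        by (simp add: linear_add[OF metric_linear(2)] metric_symmetric[of _ v w'])
    qed
    ultimately show "x = 0"
      using vw screen_nondegenerate screen_transversal_nondegenerate unfolding nondegenerate_on_def
      by (metis add_0)
  qed
  then obtain y where y: "y \<in> ?W" "e - y \<in> perp (g (\<iota> p)) ?W"
    using nondegenerate_complement[OF metric_bilinear W] by blast
  then obtain \<xi> l where l: "\<xi> \<in> radical A g B \<iota> p" "l \<in> ltr p" "e - y = \<xi> + l"
    using ltr_complement by (metis (no_types, lifting) direct_sumE)
  obtain v s where vs: "v \<in> STM p" "s \<in> STMp p" "y = v + s" using y(1) by blast
  have "v + \<xi> \<in> tangent A B \<iota> p"
    using vs(1) l(1) screen_subset(1) by (intro subspace_add subspaces) (auto simp: radical_def)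
  moreover have "e = (v + \<xi>) + l + s" using l(3) vs(3) by (simp add: algebra_simps)
  ultimately show thesis using that l(2) vs(2) by blast
qed

text \<open>With \<open>t = v + \<xi>\<close>, the vector \<open>v + s\<close> equals
  \<open>- (\<xi> + l)\<close> and is thus orthogonal to both screens. Their non-degeneracy gives
  \<open>v = 0\<close> and \<open>s = 0\<close>; then \<open>l\<close> is also radical, and
  \<open>ltr p\<close> meets the radical trivially.\<close>

lemma transversal_decomp_zero:
  assumes "t \<in> tangent A B \<iota> p" "l \<in> ltr p" "s \<in> STMp p" "t + l + s = 0"
  shows "l = 0" "s = 0"
proof -
  let ?P = "perp (g (\<iota> p)) {v + w |v w. v \<in> STM p \<and> w \<in> STMp p}"
  have P: "subspace ?P" by (rule subspace_perp[OF metric_bilinear])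
  obtain v \<xi> where v: "v \<in> STM p" "\<xi> \<in> radical A g B \<iota> p" "t = v + \<xi>"
    using screen_sum[of p] assms(1) by (auto simp: orthogonal_sum_def elim: direct_sumE)
  have rl: "radical A g B \<iota> p \<subseteq> ?P" "ltr p \<subseteq> ?P"
    using direct_sum_sub[OF ltr_complement] subspaces[THEN subspace_0] by auto
  then have "- (\<xi> + l) \<in> ?P"
    using v(2) assms(2) by (intro subspace_neg[OF P] subspace_add[OF P]) auto
  moreover have vs: "- (\<xi> + l) = v + s"
    using assms(4) v(3) by (simp add: algebra_simps eq_neg_iff_add_eq_0 neg_eq_iff_add_eq_0)
  ultimately have perp: "g (\<iota> p) (v + s) (v' + w') = 0" if "v' \<in> STM p" "w' \<in> STMp p" for v' w'
    using that by (auto simp: perp_def)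
  have "g (\<iota> p) v v' = 0" if "v' \<in> STM p" for v'
    using perp[OF that subspace_0[OF subspaces(2)]] screens_orthogonal[OF that assms(3)]
    by (simp add: linear_add[OF metric_linear(2)])
  then have v0: "v = 0" using v(1) screen_nondegenerate unfolding nondegenerate_on_def by blast
  have "g (\<iota> p) s w' = 0" if "w' \<in> STMp p" for w'
    using perp[OF subspace_0[OF subspaces(1)] that] v0 by simp
  then show "s = 0"
    using assms(3) screen_transversal_nondegenerate unfolding nondegenerate_on_def by blast
  then have "l = - \<xi>" using vs v0 by (simp add: eq_neg_iff_add_eq_0 add.commute)
  then have "l \<in> radical A g B \<iota> p" using v(2) subspace_neg[OF subspaces(6)] by simp
  then show "l = 0" using assms(2) ltr_complement[of p] by (auto simp: direct_sum_def)
qed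

lemma transversal_decomp_unique:
  assumes "t \<in> tangent A B \<iota> p" "l \<in> ltr p" "s \<in> STMp p"
    and "t' \<in> tangent A B \<iota> p" "l' \<in> ltr p" "s' \<in> STMp p"
    and "t + l + s = t' + l' + s'"
  shows "l = l'" "s = s'"
  using transversal_decomp_zero[of "t - t'" p "l - l'" "s - s'"] assms subspace_diff[OF subspaces(2)]
    subspace_diff[OF subspaces(3)] subspace_diff[OF subspaces(4)]
  by (auto simp: algebra_simps)

text \<open>Uniqueness of the decomposition makes the definite descriptions in \<open>h_l\<close>
  and \<open>h_s\<close> computable from any one decomposition.\<close>

lemma h_unique:
  assumes "t \<in> tangent A B \<iota> p" "l \<in> ltr p" "s \<in> STMp p"
    and "induced_deriv A B \<iota> nabla X Z p = t + l + s"
  shows "h_l A B \<iota> nabla STMp ltr X Z p = l" "h_s A B \<iota> nabla STMp ltr X Z p = s"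
proof -
  note unique = transversal_decomp_unique[OF _ _ _ assms(1-3)]
  show "h_l A B \<iota> nabla STMp ltr X Z p = l"
    unfolding h_l_def by (rule the_equality) (use assms unique(1) in force)+
  show "h_s A B \<iota> nabla STMp ltr X Z p = s"
    unfolding h_s_def by (rule the_equality) (use assms unique(2) in force)+
qed

text \<open>Only the difference of the two derivatives will be known explicitly. Each is decomposed
  separately, and the differences of the parts must be the given \<open>l\<close> and
  \<open>s\<close>.\<close>

lemma h_diff:
  assumes "t \<in> tangent A B \<iota> p" "l \<in> ltr p" "s \<in> STMp p"
    and eq: "induced_deriv A B \<iota> nabla X Z p - induced_deriv A B \<iota> nabla X' Z' p = t + l + s"
  shows "h_l A B \<iota> nabla STMp ltr X Z p - h_l A B \<iota> nabla STMp ltr X' Z' p = l"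
    and "h_s A B \<iota> nabla STMp ltr X Z p - h_s A B \<iota> nabla STMp ltr X' Z' p = s"
proof -
  obtain t1 l1 s1 where 1: "t1 \<in> tangent A B \<iota> p" "l1 \<in> ltr p" "s1 \<in> STMp p"
    "induced_deriv A B \<iota> nabla X Z p = t1 + l1 + s1"
    by (rule transversal_decomp)
  obtain t2 l2 s2 where 2: "t2 \<in> tangent A B \<iota> p" "l2 \<in> ltr p" "s2 \<in> STMp p"
    "induced_deriv A B \<iota> nabla X' Z' p = t2 + l2 + s2"
    by (rule transversal_decomp)
  have "(t1 - t2) + (l1 - l2) + (s1 - s2) = t + l + s"
    using eq 1(4) 2(4) by (simp add: algebra_simps)
  then have "l1 - l2 = l" "s1 - s2 = s"
    using transversal_decomp_unique[of "t1 - t2" p "l1 - l2" "s1 - s2" t l s] assms(1-3) 1 2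
      subspaces(2-4)[THEN subspace_diff] by blast+
  then show "h_l A B \<iota> nabla STMp ltr X Z p - h_l A B \<iota> nabla STMp ltr X' Z' p = l"
    and "h_s A B \<iota> nabla STMp ltr X Z p - h_s A B \<iota> nabla STMp ltr X' Z' p = s"
    using h_unique[OF 1] h_unique[OF 2] by auto
qed

end

section \<open>The action of \<open>J\<close> on tangent vectors of an STCR lightlike
  submanifold\<close>

context stcr_lightlike_submanifold
begin

sublocale kaehler_immersion A g q nabla J B \<iota>
  by unfold_locales

lemma J_inj: "J p v = 0 \<Longrightarrow> v = 0"
  using J_square[of p v] linear_0[OF J_linear] by simp

lemma stcr_subspaces:
  "subspace (D0 p)" "subspace (D1 p)" "subspace (D2 p)" "subspace (D' p)"
  "subspace (L1 p)" "subspace (L2 p)" "subspace (S p)"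
  using subbundles subbundle_subspace by blast+

lemma bundle_map_subspace: "subspace (E p) \<Longrightarrow> subspace (bundle_map J \<iota> E p)"
  unfolding bundle_map_def by (rule linear_subspace_image[OF J_linear])

lemma D1_subset: "D1 p \<subseteq> tangent A B \<iota> p" "bundle_map J \<iota> D1 p \<subseteq> tangent A B \<iota> p"
  using direct_sum_sub(1)[OF radical_decomp[of p] stcr_subspaces(2,3)[THEN subspace_0]]
    J_D1[of p] screen_subset(1)[of p] unfolding radical_def by blast+

lemma D0_subset: "D0 p \<subseteq> tangent A B \<iota> p"
proof -
  obtain E where E: "direct_sum E (bundle_map J \<iota> D1 p) (D' p)"
    "orthogonal_sum (g (\<iota> p)) (STM p) E (D0 p)"
    using screen_decomp by blast
  have "0 \<in> E"
    using direct_sum_sub(2)[OF E(1)] bundle_map_subspace stcr_subspaces subspace_0 by blast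
  then have "D0 p \<subseteq> STM p"
    using E(2) stcr_subspaces(1) by (auto simp: orthogonal_sum_def subspace_0 dest: direct_sum_sub(2))
  then show ?thesis using screen_subset(1) by blast
qed

text \<open>\<open>J\<close> preserves \<open>D0\<close> and interchanges \<open>D1\<close> and its
  image under \<open>J\<close> up to sign, as \<open>J\<close> squared is minus the
  identity.\<close>

lemma J_stcr_D:
  assumes "v \<in> stcr_D J \<iota> D0 D1 p"
  shows "J (\<iota> p) v \<in> tangent A B \<iota> p"
proof -
  obtain a b c where v: "a \<in> D0 p" "b \<in> D1 p" "c \<in> D1 p" "v = a + b + J (\<iota> p) c"
    using assms by (auto simp: stcr_D_def bundle_map_def)
  have "J (\<iota> p) a \<in> D0 p" using v(1) J_D0[of p] by (auto simp: bundle_map_def)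
  then have "J (\<iota> p) a + J (\<iota> p) b - c \<in> tangent A B \<iota> p"
    using v(1-3) D0_subset[of p] D1_subset[of p]
    by (intro subspace_diff subspace_add subspaces) (unfold bundle_map_def, blast+)
  then show ?thesis
    by (simp add: v(4) linear_add[OF J_linear] J_square)
qed

text \<open>The pointwise linear algebra behind the theorem. The last conclusion strengthens one
  direction of the equivalence before it: the components then vanish, not merely lie in the two
  subbundles.\<close>

lemma J_tangent_decomp:
  assumes "v \<in> tangent A B \<iota> p"
  obtains t l s where "t \<in> tangent A B \<iota> p" "l \<in> ltr p" "s \<in> STMp p" "J (\<iota> p) v = t + l + s"
    and "v \<in> stcr_D J \<iota> D0 D1 p \<longleftrightarrow> l \<in> L2 p \<and> s \<in> bundle_map J \<iota> L2 p"
    and "v \<in> stcr_D J \<iota> D0 D1 p \<longrightarrow> l = 0 \<and> s = 0"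
proof -
  note zero = stcr_subspaces[THEN subspace_0]
  obtain a \<rho> where v1: "a \<in> STM p" "\<rho> \<in> radical A g B \<iota> p" "v = a + \<rho>"
    using screen_sum[of p] assms by (auto simp: orthogonal_sum_def elim: direct_sumE)
  obtain d1 d2 where v2: "d1 \<in> D1 p" "d2 \<in> D2 p" "\<rho> = d1 + d2"
    using radical_decomp v1(2) by (rule direct_sumE)
  obtain E where E: "direct_sum E (bundle_map J \<iota> D1 p) (D' p)"
    "direct_sum (STM p) E (D0 p)"
    using screen_decomp unfolding orthogonal_sum_def by blast
  obtain e d0 where v3: "e \<in> E" "d0 \<in> D0 p" "a = e + d0"
    using E(2) v1(1) by (rule direct_sumE)
  obtain b d' where v4: "b \<in> bundle_map J \<iota> D1 p" "d' \<in> D' p" "e = b + d'"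
    using E(1) v3(1) by (rule direct_sumE)
  have "J (\<iota> p) d' \<in> bundle_map J \<iota> D' p" using v4(2) by (simp add: bundle_map_def)
  then obtain l s where v5: "l \<in> L1 p" "s \<in> S p" "J (\<iota> p) d' = l + s"
    using J_D'[of p] by (auto simp: orthogonal_sum_def elim: direct_sumE)
  define t where "t = J (\<iota> p) (d0 + d1 + b)"
  have D: "d0 + d1 + b \<in> stcr_D J \<iota> D0 D1 p"
    using v2(1) v3(2) v4(1) by (auto simp: stcr_D_def)
  have t: "t \<in> tangent A B \<iota> p"
    unfolding t_def by (rule J_stcr_D[OF D])
  have l: "l \<in> ltr p"
    using direct_sum_sub(1)[OF ltr_decomp zero(5,6)] v5(1) by blast
  have Jd2: "J (\<iota> p) d2 \<in> STMp p"
    using v2(2) J_D2[of p] by (auto simp: bundle_map_def)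
  then have s: "J (\<iota> p) d2 + s \<in> STMp p"
    using v5(2) S_subset[of p] by (intro subspace_add[OF subspaces(2)]) auto
  have v: "v = (d0 + d1 + b) + d2 + d'"
    by (simp add: v1 v2 v3 v4 algebra_simps)
  have Jv: "J (\<iota> p) v = t + l + (J (\<iota> p) d2 + s)"
    by (simp add: v t_def linear_add[OF J_linear] v5(3) algebra_simps)
  \<comment> \<open>If \<open>v\<close> is in \<open>D\<close>, then \<open>J v\<close> is tangent
    and has the decomposition with zero transversal parts; uniqueness forces the parts found here to
    be zero.\<close>
  have D_zero: "l = 0 \<and> J (\<iota> p) d2 + s = 0" if "v \<in> stcr_D J \<iota> D0 D1 p"
    using transversal_decomp_unique[OF t l s J_stcr_D[OF that] subspace_0 subspace_0] subspaces(2,3) Jv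
    by simp
  have "v \<in> stcr_D J \<iota> D0 D1 p" if L2: "l \<in> L2 p" "J (\<iota> p) d2 + s \<in> bundle_map J \<iota> L2 p"
  proof -
    have l0: "l = 0" using ltr_decomp[of p] L2(1) v5(1) by (auto simp: direct_sum_def)
    obtain l2 where l2: "l2 \<in> L2 p" "J (\<iota> p) d2 + s = J (\<iota> p) l2"
      using L2(2) by (auto simp: bundle_map_def)
    \<comment> \<open>A new \<open>E\<close>, now inside the screen transversal bundle:
      \<open>s\<close> will lie both in this \<open>E\<close> and in its complement
      \<open>S p\<close>, so it vanishes.\<close>
    obtain E where E: "direct_sum E (bundle_map J \<iota> D2 p) (bundle_map J \<iota> L2 p)"
      "direct_sum (STMp p) E (S p)"
      using screen_transversal_decomp unfolding orthogonal_sum_def by blast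
    have s_eq: "s = J (\<iota> p) (- d2) + J (\<iota> p) l2"
      using l2(2) by (simp add: linear_neg[OF J_linear] algebra_simps)
    have "J (\<iota> p) (- d2) \<in> bundle_map J \<iota> D2 p" "J (\<iota> p) l2 \<in> bundle_map J \<iota> L2 p"
      using v2(2) l2(1) subspace_neg[OF stcr_subspaces(3)] by (auto simp: bundle_map_def)
    then have "s \<in> E" unfolding s_eq using E(1) by (auto simp: direct_sum_def)
    then have s0: "s = 0" using E(2) v5(2) by (auto simp: direct_sum_def)
    \<comment> \<open>With \<open>s = 0\<close>, the assumption on
      \<open>J (\<iota> p) d2 + s\<close> puts \<open>J (\<iota> p) d2\<close> into both summands of
      \<open>E\<close>.\<close>
    then have "J (\<iota> p) d2 \<in> bundle_map J \<iota> D2 p \<inter> bundle_map J \<iota> L2 p"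
      using v2(2) L2(2) by (auto simp: bundle_map_def)
    then have "d2 = 0" using E(1) J_inj by (auto simp: direct_sum_def)
    moreover have "d' = 0" using v5(3) l0 s0 J_inj by simp
    ultimately show ?thesis using D v by simp
  qed
  moreover have "0 \<in> bundle_map J \<iota> L2 p"
    using subspace_0[OF bundle_map_subspace[OF stcr_subspaces(6)]] .
  ultimately have "v \<in> stcr_D J \<iota> D0 D1 p \<longleftrightarrow> l \<in> L2 p \<and> J (\<iota> p) d2 + s \<in> bundle_map J \<iota> L2 p"
    using D_zero zero(6) by metis
  then show thesis using that t l s Jv D_zero by blast
qed

text \<open>Applies \<open>J_tangent_decomp\<close> to the pushed bracket: the difference of the two
  induced derivatives is \<open>J\<close> of that bracket, so its transversal parts are the
  differences of \<open>h_l\<close> and of \<open>h_s\<close>.\<close>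

lemma h_J_lie_bracket:
  assumes X: "smooth_vector_field B UNIV X" and Y: "smooth_vector_field B UNIV Y"
  defines "hl \<equiv> h_l A B \<iota> nabla STMp ltr X (\<lambda>x. J (\<iota> x) (push A B \<iota> x (Y x)))"
    and "hl' \<equiv> h_l A B \<iota> nabla STMp ltr Y (\<lambda>x. J (\<iota> x) (push A B \<iota> x (X x)))"
    and "hs \<equiv> h_s A B \<iota> nabla STMp ltr X (\<lambda>x. J (\<iota> x) (push A B \<iota> x (Y x)))"
    and "hs' \<equiv> h_s A B \<iota> nabla STMp ltr Y (\<lambda>x. J (\<iota> x) (push A B \<iota> x (X x)))"
    and "V \<equiv> \<lambda>p. push A B \<iota> p (lie_bracket B X Y p)"
  shows "V p \<in> stcr_D J \<iota> D0 D1 p \<longleftrightarrow> hl p - hl' p \<in> L2 p \<and> hs p - hs' p \<in> bundle_map J \<iota> L2 p"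
    and "V p \<in> stcr_D J \<iota> D0 D1 p \<Longrightarrow> hl p - hl' p = 0 \<and> hs p - hs' p = 0"
proof -
  have "V p \<in> tangent A B \<iota> p" by (simp add: V_def tangent_def)
  then obtain t l s where d: "t \<in> tangent A B \<iota> p" "l \<in> ltr p" "s \<in> STMp p" "J (\<iota> p) (V p) = t + l + s"
    and iff: "V p \<in> stcr_D J \<iota> D0 D1 p \<longleftrightarrow> l \<in> L2 p \<and> s \<in> bundle_map J \<iota> L2 p"
    and zero: "V p \<in> stcr_D J \<iota> D0 D1 p \<longrightarrow> l = 0 \<and> s = 0"
    by (rule J_tangent_decomp)
  have "induced_deriv A B \<iota> nabla X (\<lambda>x. J (\<iota> x) (push A B \<iota> x (Y x))) p -
      induced_deriv A B \<iota> nabla Y (\<lambda>x. J (\<iota> x) (push A B \<iota> x (X x))) p = t + l + s"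
    \<comment> \<open>\<open>t + l + s\<close> is folded back to \<open>J (\<iota> p) (V p)\<close>;
      then \<open>J\<close> is pulled out of both derivatives, and the bracket is replaced by the
      torsion-free difference.\<close>
    unfolding d(4)[symmetric]
    unfolding induced_deriv_J[OF smooth_along_push[OF X]] induced_deriv_J[OF smooth_along_push[OF Y]]
      V_def induced_deriv_torsion_free[OF X Y, symmetric] linear_diff[OF J_linear] ..
  note h = h_diff[OF d(1-3) this, folded hl_def hl'_def hs_def hs'_def]
  show "V p \<in> stcr_D J \<iota> D0 D1 p \<longleftrightarrow> hl p - hl' p \<in> L2 p \<and> hs p - hs' p \<in> bundle_map J \<iota> L2 p"
    and "V p \<in> stcr_D J \<iota> D0 D1 p \<Longrightarrow> hl p - hl' p = 0 \<and> hs p - hs' p = 0"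
    using iff zero unfolding h by blast+
qed

end

theorem theorem3p4:
  fixes A :: "('p::{t2_space, second_countable_topology}, 'e::euclidean_space) chart set"
    and g :: "'p \<Rightarrow> 'e \<Rightarrow> 'e \<Rightarrow> real"
    and q :: nat
    and nabla :: "'p \<Rightarrow> 'e \<Rightarrow> ('p \<Rightarrow> 'e) \<Rightarrow> 'e"
    and J :: "'p \<Rightarrow> 'e \<Rightarrow> 'e"
    and B :: "('m::{t2_space, second_countable_topology}, 'f::euclidean_space) chart set"
    and \<iota> :: "'m \<Rightarrow> 'p"
    and r :: nat
    and STM STMp ltr D0 D1 D2 D' L1 L2 S :: "'m \<Rightarrow> 'e set"
  assumes "stcr_lightlike_submanifold A g q nabla J B \<iota> r STM STMp ltr D0 D1 D2 D' L1 L2 S"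
  shows "integrable_distribution A B \<iota> (stcr_D J \<iota> D0 D1) \<longleftrightarrow>
    (\<forall>X\<in>fields_in A B \<iota> (stcr_D J \<iota> D0 D1). \<forall>Y\<in>fields_in A B \<iota> (stcr_D J \<iota> D0 D1).
      (\<lambda>p. h_s A B \<iota> nabla STMp ltr X (\<lambda>x. J (\<iota> x) (push A B \<iota> x (Y x))) p
         - h_s A B \<iota> nabla STMp ltr Y (\<lambda>x. J (\<iota> x) (push A B \<iota> x (X x))) p)
        \<in> sections A B \<iota> (bundle_map J \<iota> L2) \<and>
      (\<lambda>p. h_l A B \<iota> nabla STMp ltr X (\<lambda>x. J (\<iota> x) (push A B \<iota> x (Y x))) p
         - h_l A B \<iota> nabla STMp ltr Y (\<lambda>x. J (\<iota> x) (push A B \<iota> x (X x))) p)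
        \<in> sections A B \<iota> L2)"
  (is "_ = (\<forall>X\<in>_. \<forall>Y\<in>_. (\<lambda>p. ?hs X Y p) \<in> _ \<and> (\<lambda>p. ?hl X Y p) \<in> _)")
proof -
  interpret stcr_lightlike_submanifold A g q nabla J B \<iota> r STM STMp ltr D0 D1 D2 D' L1 L2 S
    by (rule assms)
  let ?D = "stcr_D J \<iota> D0 D1"
  \<comment> \<open>The equivalence holds for each pair \<open>X\<close>, \<open>Y\<close>
    separately; quantifying over all pairs gives the theorem.\<close>
  have "lie_bracket B X Y \<in> fields_in A B \<iota> ?D \<longleftrightarrow>
      (\<lambda>p. ?hs X Y p) \<in> sections A B \<iota> (bundle_map J \<iota> L2) \<and> (\<lambda>p. ?hl X Y p) \<in> sections A B \<iota> L2"
    if "X \<in> fields_in A B \<iota> ?D" "Y \<in> fields_in A B \<iota> ?D" for X Y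
  proof -
    have X: "smooth_vector_field B UNIV X" and Y: "smooth_vector_field B UNIV Y"
      using that by (auto simp: fields_in_def)
    have "smooth_vector_field B UNIV (lie_bracket B X Y)"
      by (rule smooth_lie_bracket[OF open_UNIV X Y])
    \<comment> \<open>The bracket and its image under \<open>push\<close> are smooth, so membership
      in \<open>fields_in\<close> becomes a pointwise condition.\<close>
    then have fields: "lie_bracket B X Y \<in> fields_in A B \<iota> ?D \<longleftrightarrow>
        (\<forall>p. push A B \<iota> p (lie_bracket B X Y p) \<in> ?D p)"
      by (simp add: fields_in_def sections_def smooth_along_push)
    note h = h_J_lie_bracket[OF X Y]
    show ?thesis
    proof
      assume "lie_bracket B X Y \<in> fields_in A B \<iota> ?D"
      \<comment> \<open>Being sections includes smoothness. It comes for free here because both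
        differences are identically zero.\<close>
      then have "?hl X Y p = 0 \<and> ?hs X Y p = 0" for p
        using h(2) fields by blast
      then show "(\<lambda>p. ?hs X Y p) \<in> sections A B \<iota> (bundle_map J \<iota> L2) \<and>
          (\<lambda>p. ?hl X Y p) \<in> sections A B \<iota> L2"
        using stcr_subspaces(6) bundle_map_subspace
        by (simp add: sections_def smooth_along_zero subspace_0)
    next
      assume "(\<lambda>p. ?hs X Y p) \<in> sections A B \<iota> (bundle_map J \<iota> L2) \<and>
          (\<lambda>p. ?hl X Y p) \<in> sections A B \<iota> L2"
      then show "lie_bracket B X Y \<in> fields_in A B \<iota> ?D"
        unfolding fields h(1) by (simp add: sections_def)
    qed
  qed
  then show ?thesis
    unfolding integrable_distribution_def by blast
qed

end
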